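(* Let $0\neq\delta\in\mathbb{C}_\infty$ and let $\phi$ be a rank $2$ Drinfeld module over $\mathbb{C}_\infty$, $\phi_T=T+A\tau+B\tau^2$ with $B\neq0$, such that $B\delta^{q^2}+A\delta^q+T\delta=0$. Let $\jmath=A^{q+1}/B$. Fix a choice of $(q-1)$-st root of $T/B$ and set $c:=\delta^{-1}(T/B)^{1/(q-1)}$. Let $\zeta\in\mathbb{C}_\infty$ be a root of $x^q-\delta^{q-1}x=c$. Then: (i) If $v(\jmath)\ge-q$, then $v(\delta)=v(\zeta)=\frac{-(1+v(B))}{q^2-1}$; hence $\log_\phi$ converges at $\delta$ and $\zeta$, and $\Lambda_\phi$ is generated (as an $\mathbb{F}_q[T]$-module) by $T\log_\phi(\delta)$ and $T\log_\phi(\zeta)$. (ii) If $v(\jmath)<-q$ and $v(\delta)=\frac{-(1+v(A))}{q-1}$, then $\log_\phi$ converges at $\delta$ and $T\log_\phi(\delta)\in\Lambda_\phi$. Furthermore $v(\zeta)=\frac{v(A)-v(B)}{q^2-q}$, and $\log_\phi$ converges on all of $V_\phi$ if and only if $v(\jmath)>-q^2$; if $v(\jmath)>-q^2$ then $\Lambda_\phi$ is generated by $T\log_\phi(\delta)$ and $T\log_\phi(\zeta)$. (iii) If $v(\jmath)<-q$ and $v(\delta)=\frac{v(A)-v(B)}{q^2-q}$, then $v(\zeta)=\frac{-(1+v(A))}{q-1}$, $\log_\phi$ converges at $\zeta$, and $T\log_\phi(\zeta)\in\Lambda_\phi$. Again $\log_\phi$ converges on all of $V_\phi$ if and only if $v(\jmath)>-q^2$,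 in which case $\Lambda_\phi$ is generated by $T\log_\phi(\delta)$ and $T\log_\phi(\zeta)$.
   Context: $q$ is a prime power, $v$ the valuation on $\mathbb{F}_q(T)$ with $v(T)=-1$, extended to $\mathbb{C}_\infty$ (completion of an algebraic closure of the $v$-adic completion of $\mathbb{F}_q(T)$). $\tau$ is the $q$-Frobenius. The exponential $e_\phi(z)=z+\sum_{n\ge1}\alpha_nz^{q^n}$ is the entire function with $e_\phi(Tz)=Te_\phi(z)+Ae_\phi(z)^q+Be_\phi(z)^{q^2}$; $\log_\phi(z)=\sum\beta_nz^{q^n}$ ($\beta_0=1$) is its composition-inverse power series (characterized by $T\log_\phi(z)=\log_\phi(\phi_T(z))$), evaluated where the series converges. $\Lambda_\phi$ (the period lattice) is the set of zeros of $e_\phi$, an $\mathbb{F}_q[T]$-lattice of rank 2. $V_\phi=\{x\in\mathbb{C}_\infty: Bx^{q^2}+Ax^q+Tx=0\}$.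
   Formalization: In (iii) the claims on v(ζ), convergence at ζ and T log(ζ) ∈ Λ fail for some roots ζ (those with v(ζ)=v(δ)); they are proved for ζ with v(ζ)≠v(δ), and some root with the stated valuation is shown to exist. The iff and the generation claim hold for every root ζ. *)

theory Defs
  imports
    "HOL-Computational_Algebra.Computational_Algebra"
    "HOL-Library.Extended_Real"
    "HOL-Number_Theory.Prime_Powers"
begin

section \<open>Valued fields\<close>

definition valuation :: "('a::field \<Rightarrow> ereal) \<Rightarrow> bool" where
  "valuation v \<longleftrightarrow>
     (\<forall>x. v x \<noteq> -\<infinity>) \<and>
     (\<forall>x. v x = \<infinity> \<longleftrightarrow> x = 0) \<and>
     (\<forall>x y. v (x * y) = v x + v y) \<and>
     (\<forall>x y. v (x + y) \<ge> min (v x) (v y))"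

definition v_tendsto :: "('a::field \<Rightarrow> ereal) \<Rightarrow> (nat \<Rightarrow> 'a) \<Rightarrow> 'a \<Rightarrow> bool" where
  "v_tendsto v X l \<longleftrightarrow> (\<lambda>n. v (X n - l)) \<longlonglongrightarrow> \<infinity>"

definition v_Cauchy :: "('a::field \<Rightarrow> ereal) \<Rightarrow> (nat \<Rightarrow> 'a) \<Rightarrow> bool" where
  "v_Cauchy v X \<longleftrightarrow> (\<forall>r::real. \<exists>N. \<forall>m\<ge>N. \<forall>n\<ge>N. v (X m - X n) \<ge> ereal r)"

definition v_closure :: "('a::field \<Rightarrow> ereal) \<Rightarrow> 'a set \<Rightarrow> 'a set" where
  "v_closure v S = {l. \<exists>X. (\<forall>n. X n \<in> S) \<and> v_tendsto v X l}"

definition v_complete :: "('a::field \<Rightarrow> ereal) \<Rightarrow> bool" where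
  "v_complete v \<longleftrightarrow> (\<forall>X. v_Cauchy v X \<longrightarrow> (\<exists>l. v_tendsto v X l))"

text \<open>Evaluation of a formal power series; \<open>ps_eval\<close> is meaningful only where the series converges.\<close>

definition ps_sums :: "('a::field \<Rightarrow> ereal) \<Rightarrow> 'a fps \<Rightarrow> 'a \<Rightarrow> 'a \<Rightarrow> bool" where
  "ps_sums v f z s \<longleftrightarrow> v_tendsto v (\<lambda>N. \<Sum>m<N. fps_nth f m * z ^ m) s"

definition ps_converges :: "('a::field \<Rightarrow> ereal) \<Rightarrow> 'a fps \<Rightarrow> 'a \<Rightarrow> bool" where
  "ps_converges v f z \<longleftrightarrow> (\<exists>s. ps_sums v f z s)"

definition ps_eval :: "('a::field \<Rightarrow> ereal) \<Rightarrow> 'a fps \<Rightarrow> 'a \<Rightarrow> 'a" where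
  "ps_eval v f z = (THE s. ps_sums v f z s)"


section \<open>The field \<open>C\<^sub>\<infinity>\<close>\<close>

definition coeffs_in :: "'a::zero set \<Rightarrow> 'a poly \<Rightarrow> bool" where
  "coeffs_in S p \<longleftrightarrow> (\<forall>i. poly.coeff p i \<in> S)"

text \<open>
  The copies of \<open>F\<^sub>q\<close>, \<open>F\<^sub>q[T]\<close> and \<open>F\<^sub>q(T)\<close> inside an ambient field of characteristic \<open>p\<close>
  that contains \<open>F\<^sub>q\<close>, where \<open>q\<close> is a power of \<open>p\<close>.
\<close>

definition Fq :: "nat \<Rightarrow> 'a::field set" where
  "Fq q = {x. x ^ q = x}"

definition FqT_poly :: "nat \<Rightarrow> 'a::field \<Rightarrow> 'a set" where
  "FqT_poly q T = {poly f T | f. coeffs_in (Fq q) f}"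

definition FqT_frac :: "nat \<Rightarrow> 'a::field \<Rightarrow> 'a set" where
  "FqT_frac q T = {a / b | a b. a \<in> FqT_poly q T \<and> b \<in> FqT_poly q T \<and> b \<noteq> 0}"

definition algebraic_over :: "'a::field set \<Rightarrow> 'a \<Rightarrow> bool" where
  "algebraic_over K x \<longleftrightarrow> (\<exists>p. p \<noteq> 0 \<and> coeffs_in K p \<and> poly p x = 0)"

definition algebraically_closed :: "'a::field set \<Rightarrow> bool" where
  "algebraically_closed K \<longleftrightarrow>
     (\<forall>p. coeffs_in K p \<and> degree p > 0 \<longrightarrow> (\<exists>x\<in>K. poly p x = 0))"

text \<open>
  The locale says that the whole type \<open>'a\<close>, with valuation \<open>v\<close>, is the completion of an
  algebraic closure of the \<open>v\<close>-adic completion of \<open>F\<^sub>q(T)\<close>. Since \<open>'a\<close> is complete, the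
  completion of \<open>F\<^sub>q(T)\<close> is its closure in \<open>'a\<close>. A valuation is trivial on the finite field
  \<open>F\<^sub>q\<close>, so \<open>v T = -1\<close> determines \<open>v\<close> on \<open>F\<^sub>q(T)\<close> (it also forces \<open>T\<close> to be transcendental
  over \<open>F\<^sub>q\<close>), and the extension to the rest of \<open>'a\<close> is then unique.
\<close>

locale C_infinity =
  fixes q :: nat and v :: "'a::field \<Rightarrow> ereal" and T :: 'a
  assumes primepow_q: "primepow q"
    and char_q: "\<exists>k>0. q = CHAR('a) ^ k"
    and card_Fq: "card (Fq q :: 'a set) = q"
    and valuation: "valuation v"
    and v_T: "v T = -1"
    and complete: "v_complete v"
    and alg_closure:
      "algebraically_closed {x. algebraic_over (v_closure v (FqT_frac q T)) x}"
    and dense: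
      "v_closure v {x. algebraic_over (v_closure v (FqT_frac q T)) x} = UNIV"


section \<open>Drinfeld modules of rank 2\<close>

text \<open>
  A Drinfeld module \<open>\<phi>\<close> of rank 2 is determined by \<open>\<phi>\<^sub>T = T + A\<tau> + B\<tau>\<^sup>2\<close> with \<open>B \<noteq> 0\<close> and is
  represented by the pair \<open>(A, B)\<close>; \<open>drinfeld_T\<close> is \<open>\<phi>\<^sub>T\<close> as a function.
\<close>

definition drinfeld_T :: "nat \<Rightarrow> 'a::field \<Rightarrow> 'a \<Rightarrow> 'a \<Rightarrow> 'a \<Rightarrow> 'a" where
  "drinfeld_T q T A B x = T * x + A * x ^ q + B * x ^ (q\<^sup>2)"

definition torsion_T :: "nat \<Rightarrow> 'a::field \<Rightarrow> 'a \<Rightarrow> 'a \<Rightarrow> 'a set" where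
  "torsion_T q T A B = {x. drinfeld_T q T A B x = 0}"

definition is_drinfeld_exp ::
    "nat \<Rightarrow> ('a::field \<Rightarrow> ereal) \<Rightarrow> 'a \<Rightarrow> 'a \<Rightarrow> 'a \<Rightarrow> 'a fps \<Rightarrow> bool" where
  "is_drinfeld_exp q v T A B E \<longleftrightarrow>
     fps_nth E 1 = 1 \<and>
     (\<forall>m. m \<notin> range (\<lambda>n. q ^ n) \<longrightarrow> fps_nth E m = 0) \<and>
     (\<forall>z. ps_converges v E z) \<and>
     (\<forall>z. ps_eval v E (T * z) = drinfeld_T q T A B (ps_eval v E z))"

definition drinfeld_exp ::
    "nat \<Rightarrow> ('a::field \<Rightarrow> ereal) \<Rightarrow> 'a \<Rightarrow> 'a \<Rightarrow> 'a \<Rightarrow> 'a fps" where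
  "drinfeld_exp q v T A B = (THE E. is_drinfeld_exp q v T A B E)"

definition drinfeld_log ::
    "nat \<Rightarrow> ('a::field \<Rightarrow> ereal) \<Rightarrow> 'a \<Rightarrow> 'a \<Rightarrow> 'a \<Rightarrow> 'a fps" where
  "drinfeld_log q v T A B = fps_inv (drinfeld_exp q v T A B)"

definition log_converges ::
    "nat \<Rightarrow> ('a::field \<Rightarrow> ereal) \<Rightarrow> 'a \<Rightarrow> 'a \<Rightarrow> 'a \<Rightarrow> 'a \<Rightarrow> bool" where
  "log_converges q v T A B z \<longleftrightarrow> ps_converges v (drinfeld_log q v T A B) z"

definition log_eval ::
    "nat \<Rightarrow> ('a::field \<Rightarrow> ereal) \<Rightarrow> 'a \<Rightarrow> 'a \<Rightarrow> 'a \<Rightarrow> 'a \<Rightarrow> 'a" where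
  "log_eval q v T A B z = ps_eval v (drinfeld_log q v T A B) z"

definition period_lattice ::
    "nat \<Rightarrow> ('a::field \<Rightarrow> ereal) \<Rightarrow> 'a \<Rightarrow> 'a \<Rightarrow> 'a \<Rightarrow> 'a set" where
  "period_lattice q v T A B = {z. ps_eval v (drinfeld_exp q v T A B) z = 0}"

definition FqT_span2 :: "nat \<Rightarrow> 'a::field \<Rightarrow> 'a \<Rightarrow> 'a \<Rightarrow> 'a set" where
  "FqT_span2 q T x y = {a * x + b * y | a b. a \<in> FqT_poly q T \<and> b \<in> FqT_poly q T}"

end

theory Submission
  imports Defs
begin

text \<open>
  Choose a real \<open>w\<close> with \<open>v A \<ge> -1 - (q - 1) w\<close> and \<open>v B \<ge> -1 - (q\<^sup>2 - 1) w\<close>; the least such \<open>w\<close> is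
  the largest valuation of a nonzero \<open>T\<close>-torsion point. Then the coefficients of \<open>exp\<close> and \<open>log\<close>
  at \<open>z ^ q\<^sup>n\<close> have valuation at least \<open>(q\<^sup>n - 1)(1 - w)\<close>, so on the disc \<open>v z > w - 1\<close> the
  logarithm converges and both series are mutually inverse isometries. The equation for \<open>\<zeta>\<close> comes
  from splitting off \<open>\<tau> - \<delta>\<^sup>q\<^sup>-\<^sup>1\<close> on the right of \<open>\<phi>\<^sub>T\<close>, so \<open>\<delta>\<close> and \<open>\<zeta>\<close> form an \<open>F\<^sub>q\<close>-basis of the
  \<open>T\<close>-torsion. If both lie in the disc, dividing periods repeatedly by \<open>T\<close> shows that
  \<open>T log \<delta>\<close> and \<open>T log \<zeta>\<close> generate the lattice. The Newton polygon of \<open>\<phi>\<^sub>T\<close> has one slope when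
  \<open>v j \<ge> -q\<close> and two slopes \<open>w2 < w1\<close> otherwise; in the latter case the disc is exactly the domain
  of convergence of \<open>log\<close>, and \<open>w2 > w1 - 1\<close> means \<open>v j > -q\<^sup>2\<close>.
\<close>

section \<open>Valuations and convergence\<close>

context C_infinity
begin

lemma v_not_MInf [simp]: "v x \<noteq> -\<infinity>"
  and v_eq_PInf_iff [simp]: "v x = \<infinity> \<longleftrightarrow> x = 0"
  and v_mult: "v (x * y) = v x + v y"
  and v_add: "v (x + y) \<ge> min (v x) (v y)"
  using valuation by (auto simp: valuation_def)

lemma v_0 [simp]: "v 0 = \<infinity>"
  by simp

lemma v_real_cases:
  obtains "x = 0" | r where "x \<noteq> 0" "v x = ereal r"
  using v_not_MInf[of x] v_eq_PInf_iff[of x] by (cases "v x") auto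

lemma v_1 [simp]: "v 1 = 0"
proof (cases "1 :: 'a" rule: v_real_cases)
  case (2 r)
  then show ?thesis using v_mult[of 1 1] by simp
qed auto

lemma v_power: "v x = ereal r \<Longrightarrow> v (x ^ n) = ereal (real n * r)"
  by (induction n) (auto simp: v_mult algebra_simps zero_ereal_def)

lemma v_root_of_unity:
  assumes "x ^ n = 1" "n > 0"
  shows "v x = 0"
proof (cases x rule: v_real_cases)
  case 1
  then show ?thesis using assms by (simp add: power_0_left)
next
  case (2 r)
  then show ?thesis using v_power[of x r n] assms by (simp add: zero_ereal_def)
qed

lemma v_neg_1: "v (-1) = 0"
  by (rule v_root_of_unity[of _ 2]) auto

lemma v_minus [simp]: "v (- x) = v x"
  using v_mult[of "-1" x] v_neg_1 by simp

lemma v_diff: "v (x - y) \<ge> min (v x) (v y)"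
  using v_add[of x "- y"] by simp

lemma v_minus_commute: "v (x - y) = v (y - x)"
  using v_minus[of "x - y"] by simp

lemma v_add_ge: "r \<le> v x \<Longrightarrow> r \<le> v y \<Longrightarrow> r \<le> v (x + y)"
  using v_add[of x y] by (auto simp: min_def split: if_splits)

lemma v_diff_ge: "r \<le> v x \<Longrightarrow> r \<le> v y \<Longrightarrow> r \<le> v (x - y)"
  using v_diff[of x y] by (auto simp: min_def split: if_splits)

lemma v_sum_ge: "(\<And>i. i \<in> I \<Longrightarrow> r \<le> v (f i)) \<Longrightarrow> r \<le> v (sum f I)"
  by (induction I rule: infinite_finite_induct) (auto intro: v_add_ge)

lemma v_mult_ge: "ereal r \<le> v x \<Longrightarrow> ereal s \<le> v y \<Longrightarrow> ereal (r + s) \<le> v (x * y)"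
  using add_mono[of "ereal r" "v x" "ereal s" "v y"] by (simp add: v_mult)

lemma v_power_ge: "ereal r \<le> v x \<Longrightarrow> ereal (real n * r) \<le> v (x ^ n)"
proof (induction n)
  case (Suc n)
  then show ?case using v_mult_ge[of r x "real n * r" "x ^ n"] by (simp add: algebra_simps)
qed (simp add: zero_ereal_def)

lemma v_power_gt:
  assumes "ereal r < v x" "n > 0"
  shows "ereal (real n * r) < v (x ^ n)"
proof (cases x rule: v_real_cases)
  case 1
  then show ?thesis using assms by (simp add: power_0_left)
next
  case (2 s)
  then show ?thesis using v_power[of x s n] assms by simp
qed

lemma v_add_dominant:
  assumes "v x < v y"
  shows "v (x + y) = v x"
proof (rule antisym)
  show "v x \<le> v (x + y)" using assms by (intro v_add_ge) auto
  show "v (x + y) \<le> v x"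
    using v_diff[of "x + y" y] assms by (auto simp: min_def split: if_splits)
qed

lemma v_divide:
  assumes "v x = ereal r" "v y = ereal s"
  shows "v (x / y) = ereal (r - s)"
proof -
  have "y \<noteq> 0" using assms by auto
  then have "v x = v (x / y) + v y" using v_mult[of "x / y" y] by simp
  then show ?thesis using assms by (cases "v (x / y)") auto
qed

lemma v_divide_ge:
  assumes "ereal r \<le> v x" "v y = ereal s"
  shows "ereal (r - s) \<le> v (x / y)"
proof (cases x rule: v_real_cases)
  case (2 t)
  then show ?thesis using v_divide[of x t y s] assms by simp
qed simp

text \<open>The ultrametric fact behind Newton polygons: applied to the three terms of \<phi>_T(x) =
  0 it leaves only one or two possible values for the valuation of a nonzero torsion point.\<close>

lemma zero_sum_min_attained_twice:
  assumes "x + y + z = 0" "v x < v y" "v x < v z"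
  shows False
proof -
  have "v x < v (y + z)" using assms v_add[of y z] by (auto simp: min_def split: if_splits)
  then have "v (x + (y + z)) = v x" by (rule v_add_dominant)
  then show False using assms by (simp add: add.assoc)
qed

section \<open>The Frobenius map, the elements of F_q and the powers of \<open>T\<close>\<close>

lemma q_ge_2: "q \<ge> 2"
  using primepow_gt_Suc_0[OF primepow_q] by simp

lemma q_pos: "q > 0" and q_minus_1_pos: "q - 1 > 0" and q_minus_1_real: "real (q - 1) = real q - 1"
  using q_ge_2 by (auto simp: of_nat_diff)

lemma inj_q_power: "inj ((^) q)"
  using q_ge_2 by (auto simp: inj_on_def)

lemma q_power_inject [simp]: "q ^ m = q ^ n \<longleftrightarrow> m = n"
  using q_ge_2 by auto

lemma q_power_real_ge_1: "1 \<le> real q ^ n"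
  using q_ge_2 by (intro one_le_power) simp

lemma prime_CHAR: "prime CHAR('a)"
proof -
  obtain k where k: "k > 0" "q = CHAR('a) ^ k" using char_q by blast
  then have "CHAR('a) > 0" using q_pos by (cases "CHAR('a) = 0") auto
  then show ?thesis by (rule prime_CHAR_semidom)
qed

lemma q_power_char: "\<exists>k. q ^ n = CHAR('a) ^ k"
  using char_q by (metis power_mult)

lemma frob_add: "(x + y :: 'a) ^ (q ^ n) = x ^ (q ^ n) + y ^ (q ^ n)"
  using q_power_char[of n] freshmans_dream'[OF prime_CHAR] by metis

lemma frob_add_fps: "(x + y :: 'a fps) ^ (q ^ n) = x ^ (q ^ n) + y ^ (q ^ n)"
  using q_power_char[of n] freshmans_dream'[where 'a = "'a fps"] prime_CHAR by (metis semiring_char_fps)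

lemma frob_minus: "(- x :: 'a) ^ (q ^ n) = - (x ^ (q ^ n))"
  using frob_add[of x "-x" n] q_pos by (simp add: power_0_left eq_neg_iff_add_eq_0 add.commute)

lemma frob_diff: "(x - y :: 'a) ^ (q ^ n) = x ^ (q ^ n) - y ^ (q ^ n)"
  using frob_add[of x "-y" n] by (simp add: frob_minus)

lemma frob_sum: "(sum f I :: 'a) ^ (q ^ n) = (\<Sum>i\<in>I. f i ^ (q ^ n))"
  using q_power_char[of n] freshmans_dream_sum'[OF prime_CHAR] by metis

lemma frob_sum_fps: "(sum f I :: 'a fps) ^ (q ^ n) = (\<Sum>i\<in>I. f i ^ (q ^ n))"
  using q_power_char[of n] freshmans_dream_sum'[where 'a = "'a fps"] prime_CHAR by (metis semiring_char_fps)

lemma frob_diff1: "(x - y :: 'a) ^ q = x ^ q - y ^ q"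
  using frob_diff[of x y 1] by simp

lemma Fq_power: "a \<in> Fq q \<Longrightarrow> (a :: 'a) ^ (q ^ n) = a"
  by (induction n) (auto simp: Fq_def power_mult)

lemma Fq_0 [simp]: "(0 :: 'a) \<in> Fq q"
  using q_pos by (simp add: Fq_def power_0_left)

lemma v_Fq:
  assumes "a \<in> Fq q" "a \<noteq> 0"
  shows "v a = 0"
proof (rule v_root_of_unity[of _ "q - 1"])
  have "a * a ^ (q - 1) = a" using assms q_pos by (simp add: Fq_def flip: power_Suc)
  then show "a ^ (q - 1) = 1" using assms by simp
qed (use q_ge_2 in simp)

lemma v_Fq_mult_ge:
  assumes "a \<in> Fq q" shows "v x \<le> v (a * x)"
  using assms by (cases "a = 0") (auto simp: v_mult v_Fq)

lemma T_nonzero: "T \<noteq> 0"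
  using v_T by (auto simp: one_ereal_def)

lemma v_T_ereal: "v T = ereal (- 1)"
  by (simp add: v_T one_ereal_def)

text \<open>Up to sign this Carlitz bracket is the denominator in the recursions for exp and log.
  Its first term dominates because v T < 0.\<close>

lemma v_T_bracket:
  assumes "n > 0"
  shows "v (T ^ (q ^ n) - T) = ereal (- (real q ^ n))"
proof -
  have 1: "v (T ^ (q ^ n)) = ereal (- (real q ^ n))" using v_power[OF v_T_ereal, of "q ^ n"] by simp
  have "1 < real q ^ n" using q_ge_2 assms by (intro one_less_power) auto
  then have "v (T ^ (q ^ n)) < v (- T)" by (simp add: 1 v_T_ereal del: uminus_ereal.simps)
  from v_add_dominant[OF this] show ?thesis using 1 by simp
qed

lemma T_bracket_nonzero: "n > 0 \<Longrightarrow> T ^ (q ^ n) - T \<noteq> 0"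
  using v_T_bracket[of n] by force

text \<open>\<open>T\<close> is not a root of unity since v T is nonzero. Hence a formal series that
  commutes with multiplication by \<open>T\<close> consists of its linear term alone.\<close>

lemma T_power_eq_iff: "T ^ m = T ^ n \<longleftrightarrow> m = n"
proof
  assume "T ^ m = T ^ n"
  then have "ereal (real m * - 1) = ereal (real n * - 1)"
    using v_power[OF v_T_ereal] by metis
  then show "m = n" by simp
qed simp

section \<open>Limits and infinite sums with respect to \<open>v\<close>\<close>

lemma v_tendsto_iff: "v_tendsto v X l \<longleftrightarrow> (\<forall>r. eventually (\<lambda>n. ereal r \<le> v (X n - l)) sequentially)"
  unfolding v_tendsto_def tendsto_PInfty
proof (intro iffI allI)
  fix r :: real
  { assume "\<forall>r. eventually (\<lambda>n. ereal r < v (X n - l)) sequentially"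
    then have "eventually (\<lambda>n. ereal r < v (X n - l)) sequentially" by blast
    then show "eventually (\<lambda>n. ereal r \<le> v (X n - l)) sequentially"
      by eventually_elim simp }
  { assume "\<forall>r. eventually (\<lambda>n. ereal r \<le> v (X n - l)) sequentially"
    then have "eventually (\<lambda>n. ereal (r + 1) \<le> v (X n - l)) sequentially" by blast
    then show "eventually (\<lambda>n. ereal r < v (X n - l)) sequentially"
      by eventually_elim (rule less_le_trans[of _ "ereal (r + 1)"], auto) }
qed

lemma v_tendsto_const: "v_tendsto v (\<lambda>_. x) x"
  by (auto simp: v_tendsto_iff)

lemma v_tendsto_add:
  assumes "v_tendsto v X x" "v_tendsto v Y y"
  shows "v_tendsto v (\<lambda>n. X n + Y n) (x + y)"
  unfolding v_tendsto_iff
proof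
  fix r
  have "eventually (\<lambda>n. ereal r \<le> v (X n - x)) sequentially" "eventually (\<lambda>n. ereal r \<le> v (Y n - y)) sequentially"
    using assms by (auto simp: v_tendsto_iff)
  then show "eventually (\<lambda>n. ereal r \<le> v (X n + Y n - (x + y))) sequentially"
    by eventually_elim (use v_add_ge in \<open>auto simp: add_diff_add\<close>)
qed

lemma v_tendsto_cmult:
  assumes "v_tendsto v X x"
  shows "v_tendsto v (\<lambda>n. c * X n) (c * x)"
proof (cases c rule: v_real_cases)
  case 1
  then show ?thesis by (simp add: v_tendsto_const)
next
  case (2 s)
  show ?thesis unfolding v_tendsto_iff
  proof
    fix r
    have "eventually (\<lambda>n. ereal (r - s) \<le> v (X n - x)) sequentially"
      using assms by (auto simp: v_tendsto_iff)
    then show "eventually (\<lambda>n. ereal r \<le> v (c * X n - c * x)) sequentially"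
      by eventually_elim
        (use 2 v_mult_ge[of s c "r - s"] in \<open>auto simp flip: right_diff_distrib\<close>)
  qed
qed

lemma v_tendsto_diff:
  assumes "v_tendsto v X x" "v_tendsto v Y y"
  shows "v_tendsto v (\<lambda>n. X n - Y n) (x - y)"
  using v_tendsto_add[OF assms(1) v_tendsto_cmult[OF assms(2), of "-1"]] by simp

lemma v_tendsto_frob:
  assumes "v_tendsto v X x"
  shows "v_tendsto v (\<lambda>n. X n ^ (q ^ k)) (x ^ (q ^ k))"
  unfolding v_tendsto_iff
proof
  fix r
  \<comment> \<open>The power q^k multiplies the bound by q^k, which improves it only if the bound
    is nonnegative.\<close>
  have "eventually (\<lambda>n. ereal (max 0 r) \<le> v (X n - x)) sequentially"
    using assms unfolding v_tendsto_iff by blast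
  then show "eventually (\<lambda>n. ereal r \<le> v (X n ^ (q ^ k) - x ^ (q ^ k))) sequentially"
  proof eventually_elim
    case (elim n)
    have "r \<le> real (q ^ k) * max 0 r"
      using q_power_real_ge_1[of k] mult_right_mono[of 1 "real q ^ k" "max 0 r"] by simp
    then have "ereal r \<le> ereal (real (q ^ k) * max 0 r)" by simp
    also have "\<dots> \<le> v ((X n - x) ^ (q ^ k))" using elim by (rule v_power_ge)
    finally show ?case by (simp add: frob_diff)
  qed
qed

lemma v_tendsto_ge:
  assumes "v_tendsto v X x" "eventually (\<lambda>n. r \<le> v (X n)) sequentially"
  shows "r \<le> v x"
proof -
  \<comment> \<open>The bound \<open>r\<close> may be infinite, the case needed for uniqueness of
    limits, so it is approached by real bounds.\<close>
  have "ereal s \<le> v x" if "ereal s \<le> r" for s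
  proof -
    have "eventually (\<lambda>n. ereal s \<le> v (X n - x)) sequentially"
      using assms by (auto simp: v_tendsto_iff)
    with assms(2) have "eventually (\<lambda>n. ereal s \<le> v x) sequentially"
    proof eventually_elim
      case (elim n)
      then show ?case using v_diff_ge[of "ereal s" "X n" "X n - x"] that by auto
    qed
    then show ?thesis by (auto simp: eventually_sequentially)
  qed
  then show ?thesis
    by (cases r; cases "v x") (auto, metis gt_ex not_le)
qed

lemma v_tendsto_unique:
  assumes "v_tendsto v X x" "v_tendsto v X y"
  shows "x = y"
proof -
  have "\<infinity> \<le> v (x - y)"
    using v_tendsto_ge[OF v_tendsto_diff[OF assms], of \<infinity>] by (simp add: v_minus_commute)
  then show ?thesis by simp
qed

lemma v_tendsto_compose:
  assumes "v_tendsto v X x" "filterlim f sequentially sequentially"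
  shows "v_tendsto v (\<lambda>n. X (f n)) x"
  using filterlim_compose[OF assms(1)[unfolded v_tendsto_def] assms(2)] by (simp add: v_tendsto_def)

lemma v_tendsto_Suc_iff: "v_tendsto v (\<lambda>n. X (Suc n)) x \<longleftrightarrow> v_tendsto v X x"
  unfolding v_tendsto_def using filterlim_sequentially_Suc[of "\<lambda>n. v (X n - x)"] .

text \<open>Any block of the series is at least as small as its worst term, so terms tending to 0
  already make the partial sums Cauchy.\<close>

lemma v_summable:
  assumes "(\<lambda>n. v (t n)) \<longlonglongrightarrow> \<infinity>"
  obtains s where "v_tendsto v (\<lambda>N. \<Sum>n<N. t n) s"
proof -
  have "v_Cauchy v (\<lambda>N. \<Sum>n<N. t n)"
    unfolding v_Cauchy_def
  proof
    fix r
    have "eventually (\<lambda>n. ereal r < v (t n)) sequentially"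
      using assms by (auto simp: tendsto_PInfty)
    then obtain N where N: "\<And>n. n \<ge> N \<Longrightarrow> ereal r < v (t n)" by (auto simp: eventually_sequentially)
    have *: "ereal r \<le> v ((\<Sum>i<n. t i) - (\<Sum>i<m. t i))" if "N \<le> m" "m \<le> n" for m n
    proof -
      have "(\<Sum>i<n. t i) - (\<Sum>i<m. t i) = (\<Sum>i\<in>{m..<n}. t i)"
        using that by (simp add: sum_diff_nat_ivl lessThan_atLeast0)
      moreover have "ereal r \<le> v (\<Sum>i\<in>{m..<n}. t i)"
        by (rule v_sum_ge) (use N that in \<open>auto intro: less_imp_le\<close>)
      ultimately show ?thesis by simp
    qed
    show "\<exists>N. \<forall>m\<ge>N. \<forall>n\<ge>N. ereal r \<le> v ((\<Sum>i<m. t i) - (\<Sum>i<n. t i))"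
      by (metis * nat_le_linear v_minus_commute)
  qed
  then show ?thesis using complete that by (auto simp: v_complete_def)
qed

text \<open>Consecutive partial sums have the same limit. This is the criterion by which the
  logarithm is shown to diverge.\<close>

lemma v_terms_tendsto:
  assumes "v_tendsto v (\<lambda>N. \<Sum>n<N. t n) s"
  shows "(\<lambda>n. v (t n)) \<longlonglongrightarrow> \<infinity>"
proof -
  have "v_tendsto v (\<lambda>N. (\<Sum>n<Suc N. t n) - (\<Sum>n<N. t n)) (s - s)"
    by (intro v_tendsto_diff assms) (use assms in \<open>subst v_tendsto_Suc_iff\<close>)
  then show ?thesis by (simp add: v_tendsto_def)
qed

section \<open>Additive power series\<close>

text \<open>An F_q-linear series is determined by its coefficients at the powers z^(q^n); storing
  only these lets the recursions run over n.\<close>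

definition addfps :: "(nat \<Rightarrow> 'a) \<Rightarrow> 'a fps" where
  "addfps a = Abs_fps (\<lambda>m. if m \<in> range ((^) q) then a (the_inv ((^) q) m) else 0)"

definition asums :: "(nat \<Rightarrow> 'a) \<Rightarrow> 'a \<Rightarrow> 'a \<Rightarrow> bool" where
  "asums a z s \<longleftrightarrow> v_tendsto v (\<lambda>N. \<Sum>n<N. a n * z ^ (q ^ n)) s"

text \<open>The number of powers of \<open>q\<close> below \<open>N\<close>: the first
  \<open>N\<close> terms of the power series contain the first \<open>qlog N\<close> terms of the
  sum over n.\<close>

definition qlog :: "nat \<Rightarrow> nat" where
  "qlog N = (LEAST n. N \<le> q ^ n)"

lemma addfps_nth_power [simp]: "fps_nth (addfps a) (q ^ n) = a n"
  by (simp add: addfps_def the_inv_f_f inj_q_power)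

lemma addfps_nth_other: "m \<notin> range ((^) q) \<Longrightarrow> fps_nth (addfps a) m = 0"
  by (simp add: addfps_def)

lemma addfps_nth_0 [simp]: "fps_nth (addfps a) 0 = 0"
  using q_pos by (intro addfps_nth_other) auto

lemma addfps_nth_1 [simp]: "fps_nth (addfps a) (Suc 0) = a 0"
  using addfps_nth_power[of a 0] by simp

lemma eq_addfps:
  assumes "\<And>m. m \<notin> range ((^) q) \<Longrightarrow> fps_nth f m = 0"
  shows "f = addfps (\<lambda>n. fps_nth f (q ^ n))"
proof (rule fps_ext)
  fix m show "fps_nth f m = fps_nth (addfps (\<lambda>n. fps_nth f (q ^ n))) m"
    using assms by (cases "m \<in> range ((^) q)") (auto simp: addfps_nth_other)
qed

lemma less_qlog_iff: "n < qlog N \<longleftrightarrow> q ^ n < N"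
proof
  assume "n < qlog N"
  then show "q ^ n < N" using not_less_Least[of n "\<lambda>n. N \<le> q ^ n"] by (simp add: qlog_def)
next
  assume "q ^ n < N"
  have "N \<le> q ^ N" using q_ge_2 by (intro self_le_ge2_pow) simp
  then have "N \<le> q ^ qlog N" unfolding qlog_def by (rule LeastI)
  with \<open>q ^ n < N\<close> have "q ^ n < q ^ qlog N" by linarith
  then show "n < qlog N" using q_ge_2 by simp
qed

lemma qlog_power [simp]: "qlog (q ^ K) = K"
proof -
  have "n < qlog (q ^ K) \<longleftrightarrow> n < K" for n
    using q_ge_2 by (simp add: less_qlog_iff)
  then show ?thesis by (metis less_irrefl nat_neq_iff)
qed

lemma filterlim_qlog: "filterlim qlog sequentially sequentially"
  unfolding filterlim_at_top
proof
  fix K show "eventually (\<lambda>N. K \<le> qlog N) sequentially"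
    using eventually_gt_at_top[of "q ^ K"]
    by eventually_elim (simp flip: less_qlog_iff)
qed

lemma filterlim_q_power: "filterlim ((^) q) sequentially sequentially"
  using q_ge_2 by (intro filterlim_subseq strict_monoI) simp

lemma addfps_partial_sum:
  "(\<Sum>m<N. fps_nth (addfps a) m * z ^ m) = (\<Sum>n<qlog N. a n * z ^ (q ^ n))"
proof -
  have "(\<Sum>m<N. fps_nth (addfps a) m * z ^ m)
      = (\<Sum>m\<in>(^) q ` {..<qlog N}. fps_nth (addfps a) m * z ^ m)"
    by (rule sum.mono_neutral_right) (auto simp: less_qlog_iff addfps_def)
  also have "\<dots> = (\<Sum>n<qlog N. a n * z ^ (q ^ n))"
    by (subst sum.reindex) (use q_ge_2 in \<open>auto simp: inj_on_def\<close>)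
  finally show ?thesis .
qed

text \<open>Each sequence of partial sums is the other one reindexed, along q^K in one direction and
  along \<open>qlog\<close> in the other.\<close>

lemma ps_sums_addfps: "ps_sums v (addfps a) z s \<longleftrightarrow> asums a z s"
proof
  assume "ps_sums v (addfps a) z s"
  then have "v_tendsto v (\<lambda>K. \<Sum>m<q ^ K. fps_nth (addfps a) m * z ^ m) s"
    unfolding ps_sums_def by (rule v_tendsto_compose) (rule filterlim_q_power)
  then show "asums a z s" by (simp add: asums_def addfps_partial_sum)
next
  assume "asums a z s"
  then have "v_tendsto v (\<lambda>N. \<Sum>n<qlog N. a n * z ^ (q ^ n)) s"
    unfolding asums_def by (rule v_tendsto_compose) (rule filterlim_qlog)
  then show "ps_sums v (addfps a) z s" by (simp add: ps_sums_def addfps_partial_sum)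
qed

lemma asums_unique: "asums a z s \<Longrightarrow> asums a z t \<Longrightarrow> s = t"
  unfolding asums_def by (rule v_tendsto_unique)

lemma ps_eval_addfps: "asums a z s \<Longrightarrow> ps_eval v (addfps a) z = s"
  unfolding ps_eval_def by (rule the_equality) (auto simp: ps_sums_addfps intro: asums_unique)

lemma asums_exists:
  assumes "(\<lambda>n. v (a n * z ^ (q ^ n))) \<longlonglongrightarrow> \<infinity>"
  shows "\<exists>s. asums a z s"
  using v_summable[OF assms] unfolding asums_def by metis

lemma asums_terms: "asums a z s \<Longrightarrow> (\<lambda>n. v (a n * z ^ (q ^ n))) \<longlonglongrightarrow> \<infinity>"
  unfolding asums_def by (rule v_terms_tendsto)

lemma asums_0: "asums a 0 0"
  using q_pos by (simp add: asums_def v_tendsto_const power_0_left)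

lemma asums_add: "asums a x s \<Longrightarrow> asums a y t \<Longrightarrow> asums a (x + y) (s + t)"
  unfolding asums_def using v_tendsto_add[of "\<lambda>N. \<Sum>n<N. a n * x ^ (q ^ n)"]
  by (simp add: frob_add distrib_left sum.distrib)

lemma asums_diff: "asums a x s \<Longrightarrow> asums a y t \<Longrightarrow> asums a (x - y) (s - t)"
  unfolding asums_def using v_tendsto_diff[of "\<lambda>N. \<Sum>n<N. a n * x ^ (q ^ n)"]
  by (simp add: frob_diff right_diff_distrib sum_subtractf)

lemma asums_Fq:
  assumes "c \<in> Fq q" "asums a x s"
  shows "asums a (c * x) (c * s)"
  using v_tendsto_cmult[OF assms(2)[unfolded asums_def], of c]
  by (simp add: asums_def power_mult_distrib Fq_power[OF assms(1)] sum_distrib_left mult.left_commute)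

lemma asums_coeff_add: "asums a x s \<Longrightarrow> asums b x t \<Longrightarrow> asums (\<lambda>n. a n + b n) x (s + t)"
  unfolding asums_def using v_tendsto_add[of "\<lambda>N. \<Sum>n<N. a n * x ^ (q ^ n)"]
  by (simp add: distrib_right sum.distrib)

lemma asums_coeff_diff: "asums a x s \<Longrightarrow> asums b x t \<Longrightarrow> asums (\<lambda>n. a n - b n) x (s - t)"
  unfolding asums_def using v_tendsto_diff[of "\<lambda>N. \<Sum>n<N. a n * x ^ (q ^ n)"]
  by (simp add: left_diff_distrib sum_subtractf)

lemma asums_coeff_cmult: "asums a x s \<Longrightarrow> asums (\<lambda>n. c * a n) x (c * s)"
  unfolding asums_def using v_tendsto_cmult[of "\<lambda>N. \<Sum>n<N. a n * x ^ (q ^ n)"]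
  by (simp add: sum_distrib_left mult.assoc)

lemma asums_arg_cmult: "asums a (c * x) s \<longleftrightarrow> asums (\<lambda>n. a n * c ^ (q ^ n)) x s"
  by (simp add: asums_def power_mult_distrib mult.assoc)

text \<open>Left multiplication by \<tau> in the ring of twisted power series: the coefficients of
  f(z)^q.\<close>

definition frob_shift :: "(nat \<Rightarrow> 'a) \<Rightarrow> nat \<Rightarrow> 'a" where
  "frob_shift a n = (case n of 0 \<Rightarrow> 0 | Suc k \<Rightarrow> a k ^ q)"

lemma frob_shift_simps [simp]: "frob_shift a 0 = 0" "frob_shift a (Suc n) = a n ^ q"
  by (simp_all add: frob_shift_def)

lemma asums_frob_shift:
  assumes "asums a x s"
  shows "asums (frob_shift a) x (s ^ q)"
proof -
  have "v_tendsto v (\<lambda>N. (\<Sum>n<N. a n * x ^ (q ^ n)) ^ (q ^ 1)) (s ^ (q ^ 1))"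
    using assms unfolding asums_def by (rule v_tendsto_frob)
  also have "(\<lambda>N. (\<Sum>n<N. a n * x ^ (q ^ n)) ^ (q ^ 1))
      = (\<lambda>N. \<Sum>n<Suc N. frob_shift a n * x ^ (q ^ n))"
    by (subst frob_sum, subst sum.lessThan_Suc_shift)
      (simp add: power_mult_distrib power_mult[symmetric] mult.commute)
  finally show ?thesis
    using v_tendsto_Suc_iff[of "\<lambda>N. \<Sum>n<N. frob_shift a n * x ^ (q ^ n)" "s ^ q"]
    by (simp add: asums_def del: sum.lessThan_Suc)
qed

text \<open>Right multiplication by c\<tau> in the ring of twisted power series: the coefficients of
  f(c z^q).\<close>

definition pre_shift :: "'a \<Rightarrow> (nat \<Rightarrow> 'a) \<Rightarrow> nat \<Rightarrow> 'a" where
  "pre_shift c a n = (case n of 0 \<Rightarrow> 0 | Suc k \<Rightarrow> a k * c ^ (q ^ k))"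

lemma pre_shift_simps [simp]: "pre_shift c a 0 = 0" "pre_shift c a (Suc n) = a n * c ^ (q ^ n)"
  by (simp_all add: pre_shift_def)

lemma asums_pre_shift: "asums a (c * x ^ q) s \<longleftrightarrow> asums (pre_shift c a) x s"
proof -
  have "(\<lambda>N. \<Sum>n<N. a n * (c * x ^ q) ^ (q ^ n)) = (\<lambda>N. \<Sum>n<Suc N. pre_shift c a n * x ^ (q ^ n))"
    by (subst sum.lessThan_Suc_shift)
      (simp add: power_mult_distrib power_mult[symmetric] mult.assoc)
  then show ?thesis
    using v_tendsto_Suc_iff[of "\<lambda>N. \<Sum>n<N. pre_shift c a n * x ^ (q ^ n)" s]
    by (simp add: asums_def del: sum.lessThan_Suc)
qed

text \<open>Isolates one term of a sum. It is used with the linear term for the isometry property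
  and with the first nonzero term for the identity theorem.\<close>

lemma asums_lead:
  assumes "asums a z s" "\<And>n. n \<noteq> m \<Longrightarrow> r \<le> v (a n * z ^ (q ^ n))"
  shows "r \<le> v (s - a m * z ^ (q ^ m))"
proof -
  have "v_tendsto v (\<lambda>N. (\<Sum>n<N. a n * z ^ (q ^ n)) - a m * z ^ (q ^ m)) (s - a m * z ^ (q ^ m))"
    using assms(1) unfolding asums_def by (intro v_tendsto_diff v_tendsto_const)
  moreover have "eventually (\<lambda>N. r \<le> v ((\<Sum>n<N. a n * z ^ (q ^ n)) - a m * z ^ (q ^ m))) sequentially"
    using eventually_gt_at_top[of m]
  proof eventually_elim
    case (elim N)
    have "(\<Sum>n<N. a n * z ^ (q ^ n)) - a m * z ^ (q ^ m) = (\<Sum>n\<in>{..<N} - {m}. a n * z ^ (q ^ n))"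
      using elim by (subst sum.remove[of _ m]) auto
    moreover have "r \<le> v (\<Sum>n\<in>{..<N} - {m}. a n * z ^ (q ^ n))"
      by (rule v_sum_ge) (use assms(2) in auto)
    ultimately show ?case by simp
  qed
  ultimately show ?thesis by (rule v_tendsto_ge)
qed

text \<open>Identity theorem. If \<open>a m\<close> were the first nonzero coefficient, its term
  would strictly dominate all later ones at a point close enough to 0, so the sum could not vanish
  there.\<close>

lemma asums_zero_imp_coeff_zero:
  assumes "\<And>z. asums a z 0"
  shows "a n = 0"
proof (induction n rule: less_induct)
  case (less m)
  show ?case
  proof (cases "a m" rule: v_real_cases)
    case (2 t)
    \<comment> \<open>Convergence at 1 makes the coefficients tend to 0, so their valuations have a
      common lower bound \<open>- C\<close>.\<close>
    have "eventually (\<lambda>n. ereal 0 < v (a n)) sequentially"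
      using asums_terms[OF assms[of 1]] by (simp add: tendsto_PInfty)
    then obtain N where N: "\<And>n. n \<ge> N \<Longrightarrow> ereal 0 < v (a n)" by (auto simp: eventually_sequentially)
    have "\<exists>C. \<forall>n<K. ereal (- C) \<le> v (a n)" for K
    proof (induction K)
      case (Suc K)
      then obtain C where C: "\<forall>n<K. ereal (- C) \<le> v (a n)" by blast
      obtain C' where C': "ereal (- C') \<le> v (a K)"
        by (cases "a K" rule: v_real_cases) (auto, metis add.inverse_inverse order_refl)
      have "ereal (- max C C') \<le> v (a n)" if "n < Suc K" for n
        using C C' that order_trans[of "ereal (- max C C')" "ereal (- C)"]
          order_trans[of "ereal (- max C C')" "ereal (- C')"]
        by (cases "n = K") auto
      then show ?case by blast
    qed auto
    then obtain C0 where C0: "\<forall>n<N. ereal (- C0) \<le> v (a n)" by blast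
    define C where "C = max 0 C0"
    have C: "ereal (- C) \<le> v (a n)" for n
    proof (cases "n < N")
      case True
      then show ?thesis using C0 order_trans[of "ereal (- C)" "ereal (- C0)"] by (auto simp: C_def)
    next
      case False
      then show ?thesis using N[of n] order_trans[of "ereal (- C)" "ereal 0"] by (auto simp: C_def)
    qed
    \<comment> \<open>At z = 1 / T^k the term with index m has valuation t + q^m k and every later
      one at least - C + q^(m+1) k. The difference is at least k - C - t, which is positive.\<close>
    obtain k :: nat where k: "real k > C + t" using reals_Archimedean2 by blast
    define z where "z = 1 / T ^ k"
    have vz: "v z = ereal (real k)"
      using v_divide[of 1 0 "T ^ k" "- real k"] v_power[OF v_T_ereal, of k]
      by (simp add: z_def zero_ereal_def)
    define r where "r = t + real q ^ m * real k"
    have "ereal r < ereal (- C + real q ^ Suc m * real k)"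
    proof -
      have "real q * real q ^ m * real k \<ge> 2 * real q ^ m * real k"
        using q_ge_2 by (intro mult_right_mono) auto
      moreover have "real q ^ m * real k \<ge> real k"
        using q_power_real_ge_1[of m] mult_right_mono[of 1 "real q ^ m" "real k"] by simp
      ultimately have "r < - C + real q * real q ^ m * real k" using k by (simp add: r_def)
      then show ?thesis by simp
    qed
    also have "\<dots> \<le> v (0 - a m * z ^ (q ^ m))"
    proof (rule asums_lead[OF assms])
      fix n assume "n \<noteq> m"
      show "ereal (- C + real q ^ Suc m * real k) \<le> v (a n * z ^ (q ^ n))"
      proof (cases "n < m")
        case False
        then have "real q ^ Suc m \<le> real q ^ n"
          using \<open>n \<noteq> m\<close> q_ge_2 by (intro power_increasing) auto
        then have "ereal (- C + real q ^ Suc m * real k) \<le> ereal (- C + real q ^ n * real k)"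
          by (simp del: power_Suc add: mult_right_mono)
        also have "\<dots> \<le> v (a n * z ^ (q ^ n))"
          using C[of n] v_power[OF vz, of "q ^ n"] by (intro v_mult_ge) auto
        finally show ?thesis .
      qed (simp add: less)
    qed
    also have "\<dots> = ereal r"
      using v_power[OF vz, of "q ^ m"] 2 by (simp add: v_mult r_def)
    finally show ?thesis by simp
  qed
qed

end

section \<open>The exponential and the logarithm\<close>

locale drinfeld_module = C_infinity q v T
  for q :: nat and v :: "'a::field \<Rightarrow> ereal" and T :: 'a +
  fixes A B :: 'a
begin

text \<open>Comparing coefficients of z^(q^n) in e(Tz) = \<phi>_T(e(z)) gives this
  recursion.\<close>

fun exp_coeff :: "nat \<Rightarrow> 'a" where
  "exp_coeff 0 = 1"
| "exp_coeff (Suc 0) = A / (T ^ q - T)"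
| "exp_coeff (Suc (Suc n)) =
     (A * exp_coeff (Suc n) ^ q + B * exp_coeff n ^ q\<^sup>2) / (T ^ (q ^ Suc (Suc n)) - T)"

text \<open>Comparing coefficients of z^(q^n) in T log(z) = log(\<phi>_T(z)) gives this
  recursion.\<close>

fun log_coeff :: "nat \<Rightarrow> 'a" where
  "log_coeff 0 = 1"
| "log_coeff (Suc 0) = A / (T - T ^ q)"
| "log_coeff (Suc (Suc n)) =
     (log_coeff (Suc n) * A ^ (q ^ Suc n) + log_coeff n * B ^ (q ^ n)) / (T - T ^ (q ^ Suc (Suc n)))"

lemma v_bracket_minus: "n > 0 \<Longrightarrow> v (T - T ^ (q ^ n)) = ereal (- (real q ^ n))"
  using v_T_bracket[of n] v_minus_commute by metis

lemma v_bracket1: "v (T ^ q - T) = ereal (- real q)" "v (T - T ^ q) = ereal (- real q)"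
  using v_T_bracket[of 1] v_bracket_minus[of 1] by simp_all

text \<open>The cases of the recursion in one equation: the shifts supply the zeros for small n, so
  it is the coefficient form of the functional equation.\<close>

lemma exp_coeff_frob_shift:
  "exp_coeff n * T ^ (q ^ n) =
     T * exp_coeff n + A * frob_shift exp_coeff n + B * frob_shift (frob_shift exp_coeff) n"
proof (cases n rule: exp_coeff.cases)
  case 2
  then show ?thesis using T_bracket_nonzero[of 1] q_pos by (simp add: field_simps)
next
  case (3 k)
  have "exp_coeff n * (T ^ (q ^ n) - T) = A * exp_coeff (Suc k) ^ q + B * exp_coeff k ^ q\<^sup>2"
    unfolding 3 exp_coeff.simps(3) using T_bracket_nonzero[of "Suc (Suc k)"] by simp
  then show ?thesis by (simp add: 3 algebra_simps power2_eq_square power_mult del: exp_coeff.simps)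
qed simp

lemma exp_coeff_unique:
  assumes "a 0 = 1"
    and "\<And>n. a n * T ^ (q ^ n) = T * a n + A * frob_shift a n + B * frob_shift (frob_shift a) n"
  shows "a n = exp_coeff n"
proof (induction n rule: exp_coeff.induct)
  case 2
  show ?case using assms(2)[of "Suc 0"] T_bracket_nonzero[of 1] q_pos by (simp add: assms(1) field_simps)
next
  case (3 n)
  have "a (Suc (Suc n)) * (T ^ (q ^ Suc (Suc n)) - T) = A * a (Suc n) ^ q + B * a n ^ q\<^sup>2"
    using assms(2)[of "Suc (Suc n)"]
    by (simp add: algebra_simps power2_eq_square power_mult)
  then show ?case
    unfolding exp_coeff.simps(3) using T_bracket_nonzero[of "Suc (Suc n)"] 3
    by (simp add: nonzero_eq_divide_eq)
qed (use assms in simp)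

text \<open>The coefficient form of the functional equation of the logarithm, with B\<tau>^2 written
  as the product of B\<tau> and 1\<tau>.\<close>

lemma log_coeff_pre_shift:
  "T * log_coeff n =
     log_coeff n * T ^ (q ^ n) + pre_shift A log_coeff n + pre_shift 1 (pre_shift B log_coeff) n"
proof (cases n rule: log_coeff.cases)
  case 2
  then show ?thesis using T_bracket_nonzero[of 1] q_pos by (simp add: field_simps)
next
  case (3 k)
  have "log_coeff n * (T - T ^ (q ^ n))
      = log_coeff (Suc k) * A ^ (q ^ Suc k) + log_coeff k * B ^ (q ^ k)"
    unfolding 3 log_coeff.simps(3) using T_bracket_nonzero[of "Suc (Suc k)"] by simp
  then show ?thesis by (simp add: 3 algebra_simps del: log_coeff.simps)
qed simp

section \<open>Convergence, functional equation and uniqueness of the exponential\<close>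

lemma exp_coeff_growth:
  assumes "M \<ge> 0" "ereal (- M) \<le> v A" "ereal (- M) \<le> v B"
  shows "ereal (real q ^ n * ((real n - 1) / 2 - 2 * M + M / 2 ^ n)) \<le> v (exp_coeff n)"
proof (induction n rule: exp_coeff.induct)
  case 1
  show ?case using assms(1) by (simp add: zero_ereal_def)
next
  case 2
  have "real q * (- (2 * M) + M / 2) \<le> - M - (- real q)"
    using assms(1) q_ge_2 mult_right_mono[of 2 "real q" M] by (simp add: algebra_simps)
  then have "ereal (real q * (- (2 * M) + M / 2)) \<le> ereal (- M - (- real q))" by simp
  also have "\<dots> \<le> v (A / (T ^ q - T))"
    using assms v_bracket1 by (intro v_divide_ge) auto
  finally show ?case by simp
next
  case (3 n)
  define Q where "Q = real q ^ Suc (Suc n)"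
  \<comment> \<open>This is the claimed bound divided by q^k. Division by the bracket adds 1 to it;
    the \<open>B\<close> term reaches back two indices, hence growth 1/2 per index. The decrease of
    M / 2^k pays for the loss \<open>M\<close> caused by \<open>A\<close> or \<open>B\<close>,
    because Q is at least 2^(n+2).\<close>
  define f where "f k = (real k - 1) / 2 - 2 * M + M / 2 ^ k" for k
  have "(2::real) ^ Suc (Suc n) \<le> Q" unfolding Q_def using q_ge_2 by (intro power_mono) auto
  then have "M \<le> Q * (M / 2 ^ Suc (Suc n))"
    using assms(1) mult_right_mono[of "2 ^ Suc (Suc n)" Q "M / 2 ^ Suc (Suc n)"] by simp
  moreover have "Q * f (Suc (Suc n)) \<le> Q * (f (Suc n) + 1 - M / 2 ^ Suc (Suc n))"
    by (intro mult_left_mono) (auto simp: f_def Q_def field_simps)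
  moreover have "Q * f (Suc (Suc n)) \<le> Q * (f n + 1 - M / 2 ^ Suc (Suc n))"
    using assms(1) by (intro mult_left_mono) (auto simp: f_def Q_def field_simps)
  ultimately have *: "Q * f (Suc (Suc n)) - Q \<le> - M + Q * f (Suc n)"
    "Q * f (Suc (Suc n)) - Q \<le> - M + Q * f n"
    by (simp_all add: algebra_simps)
  have "ereal (Q * f (Suc (Suc n)) - Q) \<le> ereal (- M + real q * (real q ^ Suc n * f (Suc n)))"
    using *(1) by (simp add: Q_def mult.assoc)
  also have "\<dots> \<le> v (A * exp_coeff (Suc n) ^ q)"
    using assms 3(1) by (intro v_mult_ge v_power_ge) (auto simp: f_def)
  finally have 1: "ereal (Q * f (Suc (Suc n)) - Q) \<le> v (A * exp_coeff (Suc n) ^ q)" .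
  have "ereal (Q * f (Suc (Suc n)) - Q) \<le> ereal (- M + real (q\<^sup>2) * (real q ^ n * f n))"
    using *(2) by (simp add: Q_def mult.assoc power2_eq_square)
  also have "\<dots> \<le> v (B * exp_coeff n ^ q\<^sup>2)"
    using assms 3(2) by (intro v_mult_ge v_power_ge) (auto simp: f_def)
  finally have "ereal (Q * f (Suc (Suc n)) - Q) \<le> v (B * exp_coeff n ^ q\<^sup>2)" .
  with 1 have "ereal (Q * f (Suc (Suc n)) - Q) \<le> v (A * exp_coeff (Suc n) ^ q + B * exp_coeff n ^ q\<^sup>2)"
    by (rule v_add_ge)
  then have "ereal (Q * f (Suc (Suc n)) - Q - - Q)
      \<le> v ((A * exp_coeff (Suc n) ^ q + B * exp_coeff n ^ q\<^sup>2) / (T ^ (q ^ Suc (Suc n)) - T))"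
    by (rule v_divide_ge) (simp only: v_T_bracket Q_def zero_less_Suc)
  then show ?case unfolding exp_coeff.simps(3) f_def Q_def by simp
qed

lemma exp_coeff_terms: "(\<lambda>n. v (exp_coeff n * z ^ (q ^ n))) \<longlonglongrightarrow> \<infinity>"
proof -
  have ex: "\<exists>M\<ge>0. ereal (- M) \<le> v x" for x
  proof (cases x rule: v_real_cases)
    case (2 r)
    then show ?thesis by (intro exI[of _ "\<bar>r\<bar>"]) auto
  qed (auto intro: exI[of _ 0])
  obtain M1 where M1: "M1 \<ge> 0" "ereal (- M1) \<le> v A" using ex by blast
  obtain M2 where M2: "M2 \<ge> 0" "ereal (- M2) \<le> v B" using ex by blast
  obtain R where R: "R \<ge> 0" "ereal (- R) \<le> v z" using ex by blast
  define M where "M = max M1 M2"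
  have M: "M \<ge> 0" "ereal (- M) \<le> v A" "ereal (- M) \<le> v B"
    using M1 M2 order_trans[of "ereal (- M)" "ereal (- M1)"] order_trans[of "ereal (- M)" "ereal (- M2)"]
    by (auto simp: M_def)
  show ?thesis unfolding tendsto_PInfty
  proof
    fix s :: real
    \<comment> \<open>Nonnegative, so that multiplying by q^n keeps the bound; the added 1 makes the
      final inequality strict.\<close>
    define s' where "s' = max 0 s + 1"
    obtain N :: nat where N: "real N \<ge> 2 * (s' + 2 * M + R) + 1" using real_arch_simple by blast
    show "eventually (\<lambda>n. ereal s < v (exp_coeff n * z ^ (q ^ n))) sequentially"
      using eventually_ge_at_top[of N]
    proof eventually_elim
      case (elim n)
      have "real N \<le> real n" using elim by simp
      then have "s' + 2 * M + R \<le> (real n - 1) / 2" using N by (simp add: field_simps)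
      moreover have "0 \<le> M / 2 ^ n" using M(1) by simp
      ultimately have "s' \<le> ((real n - 1) / 2 - 2 * M + M / 2 ^ n) - R"
        by linarith
      then have "s' * 1 \<le> (((real n - 1) / 2 - 2 * M + M / 2 ^ n) - R) * real q ^ n"
        using q_power_real_ge_1[of n] by (intro mult_mono) (auto simp: s'_def)
      then have "s' \<le> real q ^ n * ((real n - 1) / 2 - 2 * M + M / 2 ^ n) + real (q ^ n) * (- R)"
        by (simp add: algebra_simps)
      then have "ereal s < ereal (real q ^ n * ((real n - 1) / 2 - 2 * M + M / 2 ^ n) + real (q ^ n) * (- R))"
        by (simp add: s'_def)
      also have "\<dots> \<le> v (exp_coeff n * z ^ (q ^ n))"
        by (intro v_mult_ge v_power_ge R exp_coeff_growth M)
      finally show ?case .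
    qed
  qed
qed

definition E :: "'a fps" where "E = addfps exp_coeff"
definition L :: "'a fps" where "L = addfps log_coeff"

definition efun :: "'a \<Rightarrow> 'a" where "efun z = ps_eval v E z"

lemma asums_efun: "asums exp_coeff z (efun z)"
  using asums_exists[OF exp_coeff_terms[of z]] ps_eval_addfps by (metis efun_def E_def)

lemma efun_add: "efun (x + y) = efun x + efun y"
  and efun_diff: "efun (x - y) = efun x - efun y"
  by (blast intro: asums_unique asums_efun asums_add asums_diff)+

lemma efun_Fq: "c \<in> Fq q \<Longrightarrow> efun (c * x) = c * efun x"
  by (blast intro: asums_unique asums_efun asums_Fq)

lemma efun_0 [simp]: "efun 0 = 0"
  by (blast intro: asums_unique asums_efun asums_0)

abbreviation phi :: "'a \<Rightarrow> 'a" where "phi \<equiv> drinfeld_T q T A B"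

text \<open>Stated for an arbitrary everywhere convergent series so that it serves twice: zero
  coefficients give the functional equation of \<open>efun\<close>, and a zero value gives, by the
  identity theorem, the recursion for any other exponential.\<close>

lemma asums_functional_equation:
  assumes "\<And>z. asums a z (f z)"
  shows "asums (\<lambda>n. a n * T ^ (q ^ n) - (T * a n + A * frob_shift a n + B * frob_shift (frob_shift a) n))
    z (f (T * z) - phi (f z))"
proof -
  have "asums (\<lambda>n. a n * T ^ (q ^ n)) z (f (T * z))"
    using assms[of "T * z"] by (simp only: asums_arg_cmult)
  moreover have "asums (\<lambda>n. T * a n + A * frob_shift a n + B * frob_shift (frob_shift a) n) z
      (T * f z + A * f z ^ q + B * (f z ^ q) ^ q)"
    by (intro asums_coeff_add asums_coeff_cmult asums_frob_shift assms)
  ultimately show ?thesis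
    using asums_coeff_diff by (auto simp: drinfeld_T_def power2_eq_square power_mult)
qed

lemma efun_T: "efun (T * z) = phi (efun z)"
proof -
  have "asums (\<lambda>n. 0) z (efun (T * z) - phi (efun z))"
    using asums_functional_equation[of exp_coeff efun z] asums_efun exp_coeff_frob_shift by simp
  moreover have "asums (\<lambda>n. 0) z 0" by (simp add: asums_def v_tendsto_const)
  ultimately show ?thesis using asums_unique by fastforce
qed

lemma is_drinfeld_exp_E: "is_drinfeld_exp q v T A B E"
  unfolding is_drinfeld_exp_def
proof (intro conjI allI impI)
  show "fps_nth E 1 = 1" by (simp add: E_def)
  show "fps_nth E m = 0" if "m \<notin> range (\<lambda>n. q ^ n)" for m
    using that by (simp add: E_def addfps_nth_other)
  show "ps_converges v E z" for z
    using asums_efun[of z] by (auto simp: ps_converges_def E_def ps_sums_addfps)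
  show "ps_eval v E (T * z) = phi (ps_eval v E z)" for z
    using efun_T by (simp add: efun_def)
qed

text \<open>Gives meaning to the definite description in \<open>drinfeld_exp\<close>: the functional
  equation forces the recursion, whose solution with first coefficient 1 is unique.\<close>

lemma is_drinfeld_exp_unique:
  assumes "is_drinfeld_exp q v T A B F"
  shows "F = E"
proof -
  define a where "a n = fps_nth F (q ^ n)" for n
  have F: "F = addfps a"
    unfolding a_def by (rule eq_addfps) (use assms in \<open>auto simp: is_drinfeld_exp_def\<close>)
  have sums: "asums a z (ps_eval v F z)" for z
    using assms unfolding is_drinfeld_exp_def F ps_converges_def ps_sums_addfps
    by (metis ps_eval_addfps)
  have "ps_eval v F (T * z) = phi (ps_eval v F z)" for z
    using assms by (simp add: is_drinfeld_exp_def)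
  then have "asums (\<lambda>n. a n * T ^ (q ^ n) - (T * a n + A * frob_shift a n + B * frob_shift (frob_shift a) n))
    z 0" for z
    using asums_functional_equation[of a "ps_eval v F" z] sums by simp
  note * = asums_zero_imp_coeff_zero[OF this]
  have "a n = exp_coeff n" for n
  proof (rule exp_coeff_unique)
    show "a 0 = 1" using assms by (simp add: a_def is_drinfeld_exp_def)
  qed (use * in simp)
  then have "a = exp_coeff" by blast
  then show ?thesis by (simp add: F E_def)
qed

lemma drinfeld_exp_eq: "drinfeld_exp q v T A B = E"
  unfolding drinfeld_exp_def using is_drinfeld_exp_E is_drinfeld_exp_unique by blast

section \<open>The logarithm as formal compositional inverse\<close>

lemma addfps_frob: "addfps a ^ q = addfps (frob_shift a)"
proof (rule fps_ext)
  fix m :: nat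
  \<comment> \<open>Large enough for the coefficient in question, since m < q^(k+1).\<close>
  define k :: nat where "k = m"
  define S where "S = (\<Sum>n<k. fps_const (a n) * fps_X ^ (q ^ n))"
  define g where "g = fps_shift (q ^ k) (addfps a)"
  have S_nth: "fps_nth (\<Sum>n<k. fps_const (b n) * fps_X ^ (q ^ f n)) i = (\<Sum>n<k. if i = q ^ f n then b n else 0)"
    for b :: "nat \<Rightarrow> 'a" and f i
    by (simp add: fps_sum_nth fps_X_power_nth if_distrib cong: if_cong)
  have S1: "fps_nth S i = (if i < q ^ k then fps_nth (addfps a) i else 0)" for i
  proof (cases "i \<in> range ((^) q)")
    case True
    then obtain j where j: "i = q ^ j" by blast
    then have "fps_nth S i = (\<Sum>n<k. if n = j then a n else 0)"
      unfolding S_def S_nth by (intro sum.cong) auto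
    then show ?thesis using q_ge_2 by (simp add: j)
  next
    case False
    then show ?thesis unfolding S_def S_nth by (auto simp: addfps_nth_other intro!: sum.neutral)
  qed
  \<comment> \<open>Additivity of the Frobenius applies to the finite sum \<open>S\<close>, and the
    q-th power of the tail starts only at X^(q^(k+1)), beyond coefficient \<open>m\<close>.\<close>
  have "addfps a = S + fps_X ^ (q ^ k) * g"
    by (rule fps_ext) (simp add: S1 fps_X_power_mult_nth g_def)
  then have "addfps a ^ q = S ^ q + (fps_X ^ (q ^ k) * g) ^ q"
    using frob_add_fps[of S "fps_X ^ (q ^ k) * g" 1] by simp
  also have "(fps_X ^ (q ^ k) * g) ^ q = fps_X ^ (q ^ Suc k) * g ^ q"
    by (simp add: power_mult_distrib mult.commute flip: power_mult)
  also have "S ^ q = (\<Sum>n<k. fps_const (a n ^ q) * fps_X ^ (q ^ Suc n))"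
    using frob_sum_fps[of "\<lambda>n. fps_const (a n) * fps_X ^ (q ^ n)" "{..<k}" 1]
    by (simp add: S_def power_mult_distrib fps_const_power mult.commute flip: power_mult)
  finally have eq: "addfps a ^ q = (\<Sum>n<k. fps_const (a n ^ q) * fps_X ^ (q ^ Suc n)) + fps_X ^ (q ^ Suc k) * g ^ q" .
  have "m < q ^ m" using q_ge_2 by (intro power_gt_expt) simp
  also have "\<dots> \<le> q ^ Suc k" unfolding k_def using q_pos by (intro power_increasing) auto
  finally have m: "m < q ^ Suc k" .
  have nth: "fps_nth (addfps a ^ q) m = (\<Sum>n<k. if m = q ^ Suc n then a n ^ q else 0)"
    unfolding eq using m S_nth[of "\<lambda>n. a n ^ q" Suc m] by (simp add: fps_X_power_mult_nth)
  show "fps_nth (addfps a ^ q) m = fps_nth (addfps (frob_shift a)) m"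
  proof (cases "m \<in> range ((^) q)")
    case False
    then show ?thesis
      unfolding nth by (auto simp: addfps_nth_other simp del: power_Suc intro!: sum.neutral)
  next
    case True
    then obtain j where j: "m = q ^ j" by blast
    show ?thesis
    proof (cases j)
      case 0
      then have "q ^ j \<noteq> q ^ Suc n" for n by (simp only: q_power_inject)
      then have "fps_nth (addfps a ^ q) m = 0" unfolding nth unfolding j by (simp del: power_Suc)
      moreover have "fps_nth (addfps (frob_shift a)) m = 0"
        unfolding j addfps_nth_power 0 by simp
      ultimately show ?thesis by simp
    next
      case (Suc i)
      have "j < q ^ j" using q_ge_2 by (intro power_gt_expt) simp
      then have "i < k" using Suc by (simp add: k_def j)
      have "fps_nth (addfps a ^ q) m = (\<Sum>n<k. if n = i then a n ^ q else 0)"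
        unfolding nth unfolding j Suc by (intro sum.cong) (auto simp del: power_Suc)
      then show ?thesis using \<open>i < k\<close> by (simp add: j Suc del: power_Suc)
    qed
  qed
qed

text \<open>\<phi>_T as a formal power series, so that the functional equations become identities
  between compositions.\<close>

definition P :: "'a fps" where
  "P = fps_const T * fps_X + fps_const A * fps_X ^ q + fps_const B * fps_X ^ (q\<^sup>2)"

lemma P_nth_0: "fps_nth P 0 = 0"
  using q_pos by (simp add: P_def fps_X_power_nth)

lemma P_frob_nth:
  "fps_nth (P ^ (q ^ n)) m = (if m = q ^ n then T ^ (q ^ n) else 0)
     + (if m = q ^ Suc n then A ^ (q ^ n) else 0) + (if m = q ^ Suc (Suc n) then B ^ (q ^ n) else 0)"
proof -
  have "P ^ (q ^ n) = fps_const (T ^ (q ^ n)) * fps_X ^ (q ^ n)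
      + fps_const (A ^ (q ^ n)) * fps_X ^ (q ^ Suc n) + fps_const (B ^ (q ^ n)) * fps_X ^ (q ^ Suc (Suc n))"
    unfolding P_def
    by (simp add: frob_add_fps power_mult_distrib fps_const_power power2_eq_square mult_ac flip: power_mult)
  then show ?thesis by (simp add: fps_X_power_nth del: power_Suc)
qed

text \<open>Only the powers of \<open>P\<close> with exponent q^n enter, and by the Frobenius each
  of them has three terms. What results is \<open>log_coeff_pre_shift\<close>.\<close>

lemma L_compose_P: "L oo P = fps_const T * L"
proof (rule fps_ext)
  fix m
  have less: "m < q ^ m" using q_ge_2 by (intro power_gt_expt) simp
  have "fps_nth (L oo P) m = (\<Sum>i\<in>{0..m}. fps_nth L i * fps_nth (P ^ i) m)"
    by (simp add: fps_compose_nth)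
  \<comment> \<open>\<open>P\<close> has no constant term, so indices above m add nothing; up to q^m
    the relevant ones are exactly the powers q^n with n at most m.\<close>
  also have "\<dots> = (\<Sum>i\<in>{0..q ^ m}. fps_nth L i * fps_nth (P ^ i) m)"
    using less by (intro sum.mono_neutral_left) (auto simp: startsby_zero_power_prefix[OF P_nth_0])
  also have "\<dots> = (\<Sum>i\<in>(^) q ` {..m}. fps_nth L i * fps_nth (P ^ i) m)"
  proof (intro sum.mono_neutral_right ballI)
    fix i assume i: "i \<in> {0..q ^ m} - (^) q ` {..m}"
    have "i \<notin> range ((^) q)"
    proof
      assume "i \<in> range ((^) q)"
      then obtain n where n: "i = q ^ n" by blast
      then have "q ^ n \<le> q ^ m" using i by simp
      then have "n \<le> m" using q_ge_2 by simp
      then show False using i n by blast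
    qed
    then show "fps_nth L i * fps_nth (P ^ i) m = 0" by (simp add: L_def addfps_nth_other)
  qed (use q_ge_2 in \<open>auto intro: power_increasing\<close>)
  also have "\<dots> = (\<Sum>n\<le>m. log_coeff n * fps_nth (P ^ (q ^ n)) m)"
    by (subst sum.reindex) (use q_ge_2 in \<open>auto simp: inj_on_def L_def\<close>)
  also have "\<dots> = T * fps_nth L m"
  proof (cases "m \<in> range ((^) q)")
    case False
    then have "m \<noteq> q ^ n" for n by blast
    then have "(\<Sum>n\<le>m. log_coeff n * fps_nth (P ^ (q ^ n)) m) = 0"
      unfolding P_frob_nth by (simp del: power_Suc)
    then show ?thesis using False by (simp add: L_def addfps_nth_other)
  next
    case True
    then obtain j where j: "m = q ^ j" by blast
    have "j < q ^ j" using q_ge_2 by (intro power_gt_expt) simp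
    then have jm: "j < m" by (simp add: j)
    have mult_if: "x * (if j = k then y else 0) = (if k = j then x * y else 0)" for x y :: 'a and k
      by simp
    have "(\<Sum>n\<le>m. log_coeff n * fps_nth (P ^ (q ^ n)) m)
        = (\<Sum>n\<le>m. if n = j then log_coeff n * T ^ (q ^ n) else 0)
        + (\<Sum>n\<le>m. if Suc n = j then log_coeff n * A ^ (q ^ n) else 0)
        + (\<Sum>n\<le>m. if Suc (Suc n) = j then log_coeff n * B ^ (q ^ n) else 0)"
      unfolding P_frob_nth j q_power_inject
      by (simp only: distrib_left sum.distrib mult_if)
    also have "(\<Sum>n\<le>m. if n = j then log_coeff n * T ^ (q ^ n) else 0) = log_coeff j * T ^ (q ^ j)"
      using jm by simp
    also have "(\<Sum>n\<le>m. if Suc n = j then log_coeff n * A ^ (q ^ n) else 0) = pre_shift A log_coeff j"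
      using jm by (cases j) (auto intro!: sum.neutral)
    also have "(\<Sum>n\<le>m. if Suc (Suc n) = j then log_coeff n * B ^ (q ^ n) else 0)
        = pre_shift 1 (pre_shift B log_coeff) j"
    proof (cases j)
      case (Suc i)
      then show ?thesis using jm by (cases i) (auto intro!: sum.neutral)
    qed simp
    finally show ?thesis by (simp add: log_coeff_pre_shift L_def j)
  qed
  finally show "fps_nth (L oo P) m = fps_nth (fps_const T * L) m" by simp
qed

lemma E_compose_T: "E oo (fps_const T * fps_X) = P oo E"
proof -
  have E0: "fps_nth E 0 = 0" by (simp add: E_def)
  have "P oo E = fps_const T * E + fps_const A * E ^ q + fps_const B * (E ^ q) ^ q"
    using E0 by (simp add: P_def fps_compose_add_distrib fps_compose_power[symmetric]
      fps_const_mult_apply_left[symmetric] power2_eq_square power_mult)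
  also have "\<dots> = E oo (fps_const T * fps_X)"
  proof (rule fps_ext)
    fix m
    show "fps_nth (fps_const T * E + fps_const A * E ^ q + fps_const B * (E ^ q) ^ q) m
        = fps_nth (E oo (fps_const T * fps_X)) m"
    proof (cases "m \<in> range ((^) q)")
      case True
      then obtain j where "m = q ^ j" by blast
      then show ?thesis using exp_coeff_frob_shift[of j]
        unfolding fps_compose_linear by (simp add: E_def addfps_frob mult.commute)
    qed (simp add: fps_compose_linear E_def addfps_frob addfps_nth_other)
  qed
  finally show ?thesis ..
qed

text \<open>The two functional equations combine to M(TX) = T M(X) for the composite M. Distinct
  powers of \<open>T\<close> differ, so only the linear coefficient of M survives.\<close>

lemma L_compose_E: "L oo E = fps_X"
proof -
  have E0: "fps_nth E 0 = 0" by (simp add: E_def)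
  have TX0: "fps_nth (fps_const T * fps_X) 0 = 0" by simp
  define M where "M = L oo E"
  have "M oo (fps_const T * fps_X) = L oo (P oo E)"
    unfolding M_def by (simp add: fps_compose_assoc[OF TX0 E0, symmetric] E_compose_T)
  also have "\<dots> = fps_const T * M"
    unfolding M_def by (simp add: fps_compose_assoc[OF E0 P_nth_0] L_compose_P fps_const_mult_apply_left)
  finally have eq: "T ^ n * fps_nth M n = T * fps_nth M n" for n
    by (simp add: fps_compose_linear fps_eq_iff)
  have "fps_nth M n = 0" if "n \<noteq> 1" for n
    using eq[of n] T_power_eq_iff[of n 1] that by auto
  moreover have "fps_nth M 1 = 1"
    by (simp add: M_def fps_compose_nth L_def E_def)
  ultimately show ?thesis by (auto simp: M_def[symmetric] fps_eq_iff fps_X_def)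
qed

text \<open>\<open>L\<close> is a left inverse and \<open>fps_inv E\<close> a right inverse of
  \<open>E\<close> under composition, so they agree.\<close>

lemma drinfeld_log_eq: "drinfeld_log q v T A B = L"
proof -
  have E0: "fps_nth E 0 = 0" and E1: "fps_nth E 1 \<noteq> 0" by (simp_all add: E_def)
  have inv0: "fps_nth (fps_inv E) 0 = 0" by (simp add: fps_inv_def)
  have "L oo (E oo fps_inv E) = fps_inv E"
    using inv0 by (simp add: fps_compose_assoc[OF inv0 E0] L_compose_E)
  then show ?thesis
    by (simp add: drinfeld_log_def drinfeld_exp_eq fps_inv_right[OF E0 E1])
qed

definition lfun :: "'a \<Rightarrow> 'a" where "lfun z = ps_eval v L z"

lemma log_eval_eq: "log_eval q v T A B = lfun"
  by (simp add: fun_eq_iff log_eval_def drinfeld_log_eq lfun_def)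

lemma log_converges_iff: "log_converges q v T A B z \<longleftrightarrow> (\<exists>s. asums log_coeff z s)"
  by (simp add: log_converges_def drinfeld_log_eq ps_converges_def L_def ps_sums_addfps)

lemma asums_lfun: "log_converges q v T A B z \<Longrightarrow> asums log_coeff z (lfun z)"
  unfolding log_converges_iff lfun_def L_def using ps_eval_addfps by auto

lemma lfun_eqI: "asums log_coeff z s \<Longrightarrow> lfun z = s"
  unfolding lfun_def L_def by (rule ps_eval_addfps)

lemma period_lattice_iff: "z \<in> period_lattice q v T A B \<longleftrightarrow> efun z = 0"
  by (simp add: period_lattice_def drinfeld_exp_eq efun_def)

end

section \<open>Exp and log as inverse isometries on the disc v z > w - 1\<close>

locale drinfeld_radius = drinfeld_module q v T A B
  for q :: nat and v :: "'a::field \<Rightarrow> ereal" and T A B :: 'a +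
  fixes w :: real
  assumes vA: "ereal (- 1 - (real q - 1) * w) \<le> v A"
    and vB: "ereal (- 1 - (real q ^ 2 - 1) * w) \<le> v B"
begin

text \<open>With this bound, no term of the series has smaller valuation than its linear term
  \<open>z\<close> as long as v z is at least w - 1.\<close>

lemma exp_coeff_ge: "ereal ((real q ^ n - 1) * (1 - w)) \<le> v (exp_coeff n)"
proof (induction n rule: exp_coeff.induct)
  case 1
  show ?case by (simp add: zero_ereal_def)
next
  case 2
  have "ereal (- 1 - (real q - 1) * w - (- real q)) \<le> v (A / (T ^ q - T))"
    using vA v_bracket1 by (intro v_divide_ge) auto
  then show ?case by (simp add: algebra_simps)
next
  case (3 n)
  define Q where "Q = real q"
  define R where "R = Q ^ n"
  have Q: "Q \<ge> 2" using q_ge_2 by (simp add: Q_def)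
  have R: "R \<ge> 1" unfolding R_def Q_def by (rule q_power_real_ge_1)
  \<comment> \<open>The target bound plus the valuation of the bracket, that is, what the numerator
    must satisfy. In both comparisons below the terms in \<open>w\<close> cancel.\<close>
  define r where "r = (Q * Q * R - 1) * (1 - w) - Q * Q * R"
  have "Q * Q * 1 \<le> Q * Q * R" "Q * 1 \<le> Q * (Q * R)"
    using Q R mult_mono[of 1 Q 1 R] by (auto intro!: mult_left_mono)
  then have le1: "r \<le> - 1 - (Q - 1) * w + Q * ((Q * R - 1) * (1 - w))"
    and le2: "r \<le> - 1 - (Q ^ 2 - 1) * w + Q ^ 2 * ((R - 1) * (1 - w))"
    by (simp_all add: r_def algebra_simps power2_eq_square)
  have "ereal (- 1 - (Q - 1) * w + real q * ((Q * R - 1) * (1 - w))) \<le> v (A * exp_coeff (Suc n) ^ q)"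
    using vA 3(1) by (intro v_mult_ge v_power_ge) (auto simp: Q_def R_def)
  then have 1: "ereal r \<le> v (A * exp_coeff (Suc n) ^ q)"
    by (rule order_trans[rotated]) (use le1 in \<open>simp add: Q_def\<close>)
  have "ereal (- 1 - (Q ^ 2 - 1) * w + real (q\<^sup>2) * ((R - 1) * (1 - w))) \<le> v (B * exp_coeff n ^ q\<^sup>2)"
    using vB 3(2) by (intro v_mult_ge v_power_ge) (auto simp: Q_def R_def)
  then have "ereal r \<le> v (B * exp_coeff n ^ q\<^sup>2)"
    by (rule order_trans[rotated]) (use le2 in \<open>simp add: Q_def\<close>)
  with 1 have "ereal r \<le> v (A * exp_coeff (Suc n) ^ q + B * exp_coeff n ^ q\<^sup>2)" by (rule v_add_ge)
  then have "ereal (r - - (real q ^ Suc (Suc n)))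
      \<le> v ((A * exp_coeff (Suc n) ^ q + B * exp_coeff n ^ q\<^sup>2) / (T ^ (q ^ Suc (Suc n)) - T))"
    by (rule v_divide_ge) (simp only: v_T_bracket zero_less_Suc)
  then show ?case
    unfolding exp_coeff.simps(3) by (simp add: r_def R_def Q_def mult.assoc)
qed

text \<open>In contrast to the exponential, both terms of the numerator meet the required bound
  exactly, without slack; hence the sharp version that follows.\<close>

lemma log_coeff_ge: "ereal ((real q ^ n - 1) * (1 - w)) \<le> v (log_coeff n)"
proof (induction n rule: log_coeff.induct)
  case 1
  show ?case by (simp add: zero_ereal_def)
next
  case 2
  have "ereal (- 1 - (real q - 1) * w - (- real q)) \<le> v (A / (T - T ^ q))"
    using vA v_bracket1 by (intro v_divide_ge) auto
  then show ?case by (simp add: algebra_simps)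
next
  case (3 n)
  define Q where "Q = real q"
  define R where "R = Q ^ n"
  define r where "r = (Q * Q * R - 1) * (1 - w) - Q * Q * R"
  have eq1: "r = (Q * R - 1) * (1 - w) + Q * R * (- 1 - (Q - 1) * w)"
    and eq2: "r = (R - 1) * (1 - w) + R * (- 1 - (Q ^ 2 - 1) * w)"
    by (simp_all add: r_def algebra_simps power2_eq_square)
  have "ereal ((Q * R - 1) * (1 - w) + real (q ^ Suc n) * (- 1 - (Q - 1) * w))
      \<le> v (log_coeff (Suc n) * A ^ (q ^ Suc n))"
    using vA 3(1) by (intro v_mult_ge v_power_ge) (auto simp: Q_def R_def)
  then have 1: "ereal r \<le> v (log_coeff (Suc n) * A ^ (q ^ Suc n))"
    by (simp add: eq1 Q_def R_def)
  have "ereal ((R - 1) * (1 - w) + real (q ^ n) * (- 1 - (Q ^ 2 - 1) * w))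
      \<le> v (log_coeff n * B ^ (q ^ n))"
    using vB 3(2) by (intro v_mult_ge v_power_ge) (auto simp: Q_def R_def)
  then have "ereal r \<le> v (log_coeff n * B ^ (q ^ n))"
    by (simp add: eq2 Q_def R_def)
  with 1 have "ereal r \<le> v (log_coeff (Suc n) * A ^ (q ^ Suc n) + log_coeff n * B ^ (q ^ n))"
    by (rule v_add_ge)
  then have "ereal (r - - (real q ^ Suc (Suc n)))
      \<le> v ((log_coeff (Suc n) * A ^ (q ^ Suc n) + log_coeff n * B ^ (q ^ n)) / (T - T ^ (q ^ Suc (Suc n))))"
    by (rule v_divide_ge) (simp only: v_bracket_minus zero_less_Suc)
  then show ?case
    unfolding log_coeff.simps(3) by (simp add: r_def R_def Q_def mult.assoc)
qed

text \<open>If \<open>A\<close> attains its bound and \<open>B\<close> exceeds it, the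
  \<open>A\<close> term strictly dominates at every step and nothing cancels. This determines the
  exact domain of convergence of the logarithm.\<close>

lemma log_coeff_exact:
  assumes A: "v A = ereal (- 1 - (real q - 1) * w)"
    and B: "ereal (- 1 - (real q ^ 2 - 1) * w) < v B"
  shows "v (log_coeff n) = ereal ((real q ^ n - 1) * (1 - w))"
proof (induction n rule: log_coeff.induct)
  case 1
  show ?case by (simp add: zero_ereal_def)
next
  case 2
  have "v (A / (T - T ^ q)) = ereal (- 1 - (real q - 1) * w - (- real q))"
    using A v_bracket1 by (intro v_divide) auto
  then show ?case by (simp add: algebra_simps)
next
  case (3 n)
  define Q where "Q = real q"
  define R where "R = Q ^ n"
  define r where "r = (Q * Q * R - 1) * (1 - w) - Q * Q * R"
  have eq1: "r = (Q * R - 1) * (1 - w) + Q * R * (- 1 - (Q - 1) * w)"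
    and eq2: "r = (R - 1) * (1 - w) + R * (- 1 - (Q ^ 2 - 1) * w)"
    by (simp_all add: r_def algebra_simps power2_eq_square)
  have 1: "v (log_coeff (Suc n) * A ^ (q ^ Suc n)) = ereal r"
    using 3(1) v_power[OF A, of "q ^ Suc n"] by (simp add: v_mult eq1 Q_def R_def)
  define X where "X = B ^ (q ^ n)"
  have "ereal (real (q ^ n) * (- 1 - (Q ^ 2 - 1) * w)) < v X"
    unfolding X_def by (rule v_power_gt) (use B q_pos in \<open>auto simp: Q_def\<close>)
  then have "ereal ((R - 1) * (1 - w)) + ereal (real (q ^ n) * (- 1 - (Q ^ 2 - 1) * w))
      < ereal ((R - 1) * (1 - w)) + v X"
    by (cases "v X") auto
  moreover have "ereal r = ereal ((R - 1) * (1 - w)) + ereal (real (q ^ n) * (- 1 - (Q ^ 2 - 1) * w))"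
    by (simp add: eq2 Q_def R_def)
  moreover have "v (log_coeff n) = ereal ((R - 1) * (1 - w))"
    using 3(2) by (simp add: Q_def R_def)
  ultimately have "v (log_coeff (Suc n) * A ^ (q ^ Suc n)) < v (log_coeff n * B ^ (q ^ n))"
    by (simp only: 1 v_mult[of "log_coeff n"] X_def)
  then have "v (log_coeff (Suc n) * A ^ (q ^ Suc n) + log_coeff n * B ^ (q ^ n)) = ereal r"
    using v_add_dominant 1 by metis
  then have "v ((log_coeff (Suc n) * A ^ (q ^ Suc n) + log_coeff n * B ^ (q ^ n)) / (T - T ^ (q ^ Suc (Suc n))))
      = ereal (r - - (real q ^ Suc (Suc n)))"
    by (rule v_divide) (simp only: v_bracket_minus zero_less_Suc)
  then show ?case
    unfolding log_coeff.simps(3) by (simp add: r_def R_def Q_def mult.assoc)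
qed

lemma log_converges_gt:
  assumes "ereal (w - 1) < v x"
  shows "log_converges q v T A B x"
proof (cases x rule: v_real_cases)
  case 1
  then show ?thesis using asums_0 by (auto simp: log_converges_iff)
next
  case (2 r)
  \<comment> \<open>The excess of v x over w - 1; the n-th term has valuation at least q^n d - (1 -
    w).\<close>
  define d where "d = 1 - w + r"
  have d: "d > 0" using assms 2 by (simp add: d_def)
  have "(\<lambda>n. v (log_coeff n * x ^ (q ^ n))) \<longlonglongrightarrow> \<infinity>"
    unfolding tendsto_PInfty
  proof
    fix s :: real
    obtain N :: nat where N: "real N > (s + (1 - w)) / d" using reals_Archimedean2 by blast
    show "eventually (\<lambda>n. ereal s < v (log_coeff n * x ^ (q ^ n))) sequentially"
      using eventually_ge_at_top[of N]
    proof eventually_elim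
      case (elim n)
      have "n < q ^ n" using q_ge_2 by (intro power_gt_expt) simp
      then have "real N < real (q ^ n)" using elim by linarith
      then have "(s + (1 - w)) / d < real q ^ n" using N by (simp only: of_nat_power)
      then have "s + (1 - w) < real q ^ n * d" using d by (simp add: field_simps)
      then have "s < (real q ^ n - 1) * (1 - w) + real (q ^ n) * r"
        by (simp add: d_def algebra_simps)
      then have "ereal s < ereal ((real q ^ n - 1) * (1 - w) + real (q ^ n) * r)" by simp
      also have "\<dots> \<le> v (log_coeff n * x ^ (q ^ n))"
        using 2 by (intro v_mult_ge v_power_ge log_coeff_ge) auto
      finally show ?case .
    qed
  qed
  then show ?thesis unfolding log_converges_iff by (rule asums_exists)
qed

text \<open>Already for v x = w - 1 every term has valuation exactly w - 1, and a smaller v x only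
  lowers it, so the terms do not tend to 0.\<close>

lemma log_diverges:
  assumes "v A = ereal (- 1 - (real q - 1) * w)" "ereal (- 1 - (real q ^ 2 - 1) * w) < v B"
    and "v x \<le> ereal (w - 1)"
  shows "\<not> log_converges q v T A B x"
proof
  assume "log_converges q v T A B x"
  then obtain s where "asums log_coeff x s" by (auto simp: log_converges_iff)
  then have "eventually (\<lambda>n. ereal (w - 1) < v (log_coeff n * x ^ (q ^ n))) sequentially"
    using asums_terms by (auto simp: tendsto_PInfty)
  then obtain n where n: "ereal (w - 1) < v (log_coeff n * x ^ (q ^ n))"
    by (auto simp: eventually_sequentially)
  obtain r where r: "v x = ereal r" using assms(3) by (cases "v x") auto
  have "v (log_coeff n * x ^ (q ^ n)) = ereal ((real q ^ n - 1) * (1 - w) + real q ^ n * r)"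
    using v_power[OF r, of "q ^ n"] log_coeff_exact[OF assms(1,2), of n] by (simp add: v_mult)
  moreover have "real q ^ n * r \<le> real q ^ n * (w - 1)"
    using assms(3) r by (intro mult_left_mono) auto
  ultimately show False using n by (simp add: algebra_simps)
qed

text \<open>With d = 1 - w + r > 0 the bound equals r + (q - 1) d, hence exceeds r. It is the bound
  for the term n = 1, the weakest among the nonlinear terms. Stated for any such coefficients to
  cover both exp and log.\<close>

lemma asums_tangent:
  assumes "a 0 = 1" "\<And>n. ereal ((real q ^ n - 1) * (1 - w)) \<le> v (a n)"
    and "asums a x s" "ereal r \<le> v x" "w - 1 < r"
  shows "ereal (real q * (1 - w + r) - (1 - w)) \<le> v (s - x)"
proof -
  define d where "d = 1 - w + r"
  have d: "d > 0" using assms(5) by (simp add: d_def)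
  have "ereal (real q * d - (1 - w)) \<le> v (s - a 0 * x ^ (q ^ 0))"
  proof (rule asums_lead[OF assms(3)])
    fix n :: nat assume "n \<noteq> 0"
    then have "real q ^ 1 \<le> real q ^ n" using q_ge_2 by (intro power_increasing) auto
    then have "real q * d \<le> real q ^ n * d" using d by simp
    then have "ereal (real q * d - (1 - w)) \<le> ereal ((real q ^ n - 1) * (1 - w) + real (q ^ n) * r)"
      by (simp add: d_def algebra_simps)
    also have "\<dots> \<le> v (a n * x ^ (q ^ n))"
      by (intro v_mult_ge v_power_ge assms)
    finally show "ereal (real q * d - (1 - w)) \<le> v (a n * x ^ (q ^ n))" .
  qed
  then show ?thesis using assms(1) by (simp add: d_def)
qed

lemma asums_isometry:
  assumes "a 0 = 1" "\<And>n. ereal ((real q ^ n - 1) * (1 - w)) \<le> v (a n)"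
    and "asums a x s" "ereal (w - 1) < v x"
  shows "v s = v x"
proof (cases x rule: v_real_cases)
  case 1
  then show ?thesis using asums_unique[OF asums_0] assms(3) by blast
next
  case (2 r)
  define d where "d = 1 - w + r"
  have d: "d > 0" using assms(4) 2 by (simp add: d_def)
  have "1 * d < real q * d" using q_ge_2 d by (intro mult_strict_right_mono) auto
  then have "v x < ereal (real q * d - (1 - w))" by (simp add: 2 d_def)
  also have "\<dots> \<le> v (s - x)"
    unfolding d_def using assms 2 by (intro asums_tangent[of a]) auto
  finally have "v (x + (s - x)) = v x" by (rule v_add_dominant)
  then show ?thesis by simp
qed

lemma v_efun: "ereal (w - 1) < v x \<Longrightarrow> v (efun x) = v x"
  using asums_isometry[of exp_coeff] exp_coeff_ge asums_efun by simp

lemma v_lfun: "ereal (w - 1) < v x \<Longrightarrow> v (lfun x) = v x"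
  using asums_isometry[of log_coeff] log_coeff_ge asums_lfun log_converges_gt by simp

lemma asums_lfun_gt: "ereal (w - 1) < v x \<Longrightarrow> asums log_coeff x (lfun x)"
  by (intro asums_lfun log_converges_gt)

text \<open>Here v x must exceed w, not just w - 1: the bounds on \<open>A\<close> and
  \<open>B\<close> then put all three terms of \<phi>_T(x) into the disc, where the logarithm is
  additive and \<open>log_coeff_pre_shift\<close> applies.\<close>

lemma lfun_phi:
  assumes "ereal w < v x"
  shows "lfun (phi x) = T * lfun x"
proof (cases x rule: v_real_cases)
  case 1
  then show ?thesis using q_pos lfun_eqI[OF asums_0] by (simp add: drinfeld_T_def power_0_left)
next
  case (2 r)
  then have r: "w < r" using assms by simp
  have vx: "ereal r \<le> v x" using 2 by simp
  have 1: "ereal (w - 1) < v (T * x)" using 2 r by (simp add: v_mult v_T_ereal)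
  have "real q * w < real q * r" "real q ^ 2 * w < real q ^ 2 * r"
    using r q_pos by simp_all
  then have "ereal (w - 1) < ereal (- 1 - (real q - 1) * w + real q * r)"
    and "ereal (w - 1) < ereal (- 1 - (real q ^ 2 - 1) * w + real (q\<^sup>2) * r)"
    by (simp_all add: algebra_simps)
  then have 2: "ereal (w - 1) < v (A * x ^ q)" and 3: "ereal (w - 1) < v (B * x ^ q\<^sup>2)"
    by (blast intro: less_le_trans v_mult_ge v_power_ge vA vB vx)+
  have "asums (\<lambda>n. log_coeff n * T ^ (q ^ n)) x (lfun (T * x))"
    using asums_lfun_gt[OF 1] by (simp only: asums_arg_cmult)
  moreover have "asums (pre_shift A log_coeff) x (lfun (A * x ^ q))"
    using asums_lfun_gt[OF 2] by (simp only: asums_pre_shift)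
  moreover have "asums (pre_shift 1 (pre_shift B log_coeff)) x (lfun (B * x ^ q\<^sup>2))"
    using asums_lfun_gt[OF 3]
    by (simp only: power2_eq_square power_mult asums_pre_shift)
       (simp only: asums_pre_shift[symmetric] mult_1)
  ultimately have "asums (\<lambda>n. T * log_coeff n) x (lfun (T * x) + lfun (A * x ^ q) + lfun (B * x ^ q\<^sup>2))"
    unfolding log_coeff_pre_shift by (intro asums_coeff_add)
  moreover have "asums (\<lambda>n. T * log_coeff n) x (T * lfun x)"
    using assms by (intro asums_coeff_cmult asums_lfun_gt)
      (rule less_trans[of _ "ereal w"], auto)
  moreover have "lfun (phi x) = lfun (T * x) + lfun (A * x ^ q) + lfun (B * x ^ q\<^sup>2)"
    unfolding drinfeld_T_def
    by (intro lfun_eqI asums_add asums_lfun_gt 1 2 3)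
  ultimately show ?thesis using asums_unique by simp
qed

text \<open>
  The defect \<open>f z = log (exp z) - z\<close> satisfies \<open>f (T z) = T f z\<close> and is at least of order \<open>q \<ge> 2\<close>
  at \<open>0\<close>. Comparing \<open>f z = T\<^sup>n f (z / T\<^sup>n)\<close> for large \<open>n\<close> forces \<open>f z = 0\<close>.
\<close>

lemma lfun_efun:
  assumes z: "ereal (w - 1) < v z"
  shows "lfun (efun z) = z"
proof (cases z rule: v_real_cases)
  case 1
  then show ?thesis using lfun_eqI[OF asums_0] by simp
next
  case (2 r)
  have r: "w - 1 < r" using z 2 by simp
  define y where "y n = z / T ^ n" for n
  have y: "v (y n) = ereal (r + real n)" for n
    using v_divide[OF 2(2) v_power[OF v_T_ereal, of n]] by (simp add: y_def)
  define f where "f x = lfun (efun x) - x" for x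
  have fz: "f z = T ^ n * f (y n)" for n
  proof (induction n)
    case (Suc n)
    \<comment> \<open>One division by \<open>T\<close> takes the disc v > w - 1 into v > w, where
      \<open>lfun_phi\<close> is available; this is why the point is \<open>y (Suc n)\<close> and
      not \<open>y n\<close>.\<close>
    have "ereal w < v (y (Suc n))" using r by (simp add: y)
    moreover from this have "v (efun (y (Suc n))) = v (y (Suc n))"
      by (intro v_efun) (rule less_trans[of _ "ereal w"], auto)
    ultimately have "lfun (efun (T * y (Suc n))) = T * lfun (efun (y (Suc n)))"
      by (simp add: efun_T lfun_phi)
    moreover have "T * y (Suc n) = y n" using T_nonzero by (simp add: y_def)
    ultimately have "f (y n) = T * f (y (Suc n))" by (simp add: f_def algebra_simps)
    then show ?case using Suc by simp
  qed (simp add: y_def)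
  have vf: "ereal (real q * (1 - w + (r + real n)) - (1 - w)) \<le> v (f (y n))" for n
  proof -
    have D: "ereal (w - 1) < v (y n)" using r by (simp add: y)
    have e: "v (efun (y n)) = v (y n)" by (rule v_efun[OF D])
    have "ereal (real q * (1 - w + (r + real n)) - (1 - w)) \<le> v (efun (y n) - y n)"
      using r by (intro asums_tangent[of exp_coeff] exp_coeff_ge asums_efun) (simp_all add: y)
    moreover have "ereal (real q * (1 - w + (r + real n)) - (1 - w)) \<le> v (lfun (efun (y n)) - efun (y n))"
      using r D e by (intro asums_tangent[of log_coeff] log_coeff_ge asums_lfun_gt) (simp_all add: y)
    ultimately have "ereal (real q * (1 - w + (r + real n)) - (1 - w))
        \<le> v ((lfun (efun (y n)) - efun (y n)) + (efun (y n) - y n))"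
      by (intro v_add_ge)
    then show ?thesis by (simp add: f_def)
  qed
  show ?thesis
  proof (cases "f z" rule: v_real_cases)
    case 1
    then show ?thesis by (simp add: f_def)
  next
    case (2 s)
    obtain n :: nat where n: "real n > s + (1 - w)" using reals_Archimedean2 by blast
    have "2 * (1 - w + (r + real n)) \<le> real q * (1 - w + (r + real n))"
      using q_ge_2 r by (intro mult_right_mono) auto
    then have "ereal s < ereal (real n * - 1 + (real q * (1 - w + (r + real n)) - (1 - w)))"
      using n r by simp
    also have "\<dots> \<le> v (T ^ n * f (y n))"
      by (intro v_mult_ge vf v_power_ge) (simp add: v_T_ereal)
    also have "\<dots> = ereal s" using 2 fz by metis
    finally show ?thesis by simp
  qed
qed

text \<open>Turns the left inverse into a right inverse: exp(log z) and z have the same logarithm,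
  and the logarithm is additive and preserves valuations on the disc, so their difference is
  0.\<close>

lemma efun_lfun:
  assumes z: "ereal (w - 1) < v z"
  shows "efun (lfun z) = z"
proof -
  have l: "v (lfun z) = v z" by (rule v_lfun[OF z])
  have e: "v (efun (lfun z)) = v z" using v_efun[of "lfun z"] l z by simp
  have "lfun (efun (lfun z) - z) = lfun (efun (lfun z)) - lfun z"
    using e z by (intro lfun_eqI asums_diff asums_lfun_gt) auto
  also have "\<dots> = 0" using lfun_efun[of "lfun z"] l z by simp
  finally have 0: "lfun (efun (lfun z) - z) = 0" .
  have "ereal (w - 1) < v (efun (lfun z) - z)"
    using e z v_diff[of "efun (lfun z)" z] by (auto intro: less_le_trans)
  then have "v (efun (lfun z) - z) = v (lfun (efun (lfun z) - z))" by (simp add: v_lfun)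
  then show ?thesis by (simp add: 0)
qed

lemma efun_eq_0: "ereal (w - 1) < v z \<Longrightarrow> efun z = 0 \<Longrightarrow> z = 0"
  using v_efun[of z] by (metis v_0 v_eq_PInf_iff)

lemma torsion_lfun_period:
  assumes "ereal (w - 1) < v x" "phi x = 0"
  shows "T * lfun x \<in> period_lattice q v T A B"
  using assms by (simp add: period_lattice_iff efun_T efun_lfun)

end

section \<open>Torsion points and periods\<close>

context C_infinity
begin

lemma FqT_poly_0: "0 \<in> FqT_poly q T"
  by (auto simp: FqT_poly_def coeffs_in_def intro!: exI[of _ 0])

lemma FqT_poly_step:
  assumes "a \<in> Fq q" "f \<in> FqT_poly q T"
  shows "a + T * f \<in> FqT_poly q T"
proof -
  obtain p where p: "f = poly p T" "coeffs_in (Fq q) p" using assms(2) by (auto simp: FqT_poly_def)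
  then have "coeffs_in (Fq q) (pCons a p)"
    using assms(1) by (auto simp: coeffs_in_def coeff_pCons split: nat.splits)
  moreover have "a + T * f = poly (pCons a p) T" by (simp add: p)
  ultimately show ?thesis unfolding FqT_poly_def by blast
qed

text \<open>Horner's scheme. The descent on periods produces coefficients of the same form a + T g,
  through \<open>FqT_poly_step\<close>.\<close>

lemma FqT_poly_induct [consumes 1, case_names zero step]:
  assumes "f \<in> FqT_poly q T" "Q 0" "\<And>a g. a \<in> Fq q \<Longrightarrow> Q g \<Longrightarrow> Q (a + T * g)"
  shows "Q f"
proof -
  have "coeffs_in (Fq q) p \<Longrightarrow> Q (poly p T)" for p
  proof (induction p)
    case (pCons a p)
    have "poly.coeff (pCons a p) 0 \<in> Fq q" "poly.coeff (pCons a p) (Suc i) \<in> Fq q" for i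
      using pCons.prems unfolding coeffs_in_def by blast+
    then show ?case using pCons assms(3) by (simp add: coeffs_in_def)
  qed (simp add: assms)
  then show ?thesis using assms(1) by (auto simp: FqT_poly_def)
qed

text \<open>The kernel of \<tau> - d^(q-1) is the line F_q d.\<close>

lemma Fq_eigen:
  assumes "d \<noteq> 0" "y ^ q = d ^ (q - 1) * y"
  shows "y / d \<in> Fq q"
proof -
  have "d ^ q = d ^ (q - 1) * d" using q_pos by (simp add: power_eq_if mult.commute)
  then show ?thesis using assms by (simp add: Fq_def power_divide)
qed

lemma finite_Fq: "finite (Fq q :: 'a set)"
  using card_Fq q_pos by (intro card_ge_0_finite) simp

text \<open>As polynomials in y both sides are monic of degree \<open>q\<close> and vanish on F_q,
  which has \<open>q\<close> elements.\<close>

lemma prod_Fq: "(\<Prod>a\<in>Fq q. y - a) = y ^ q - (y :: 'a)"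
proof -
  define r where "r = (\<Prod>a\<in>Fq q. [:- a, 1 :: 'a:])"
  define p where "p = monom (1 :: 'a) q - monom 1 1"
  have deg_r: "degree r = q"
    unfolding r_def by (subst degree_prod_sum_eq) (auto simp: card_Fq)
  have lead_r: "lead_coeff r = 1"
    unfolding r_def by (simp add: lead_coeff_prod)
  have "p = r"
  proof (rule poly_eqI_degree_lead_coeff[where n = q and A = "Fq q"])
    show "poly.coeff p q = poly.coeff r q"
      using lead_r deg_r q_ge_2 by (simp add: p_def)
    show "degree p \<le> q"
      unfolding p_def using q_ge_2 by (intro degree_diff_le) (auto simp: degree_monom_eq)
    show "poly p z = poly r z" if "z \<in> Fq q" for z
    proof -
      have "poly r z = 0"
        using that finite_Fq by (auto simp: r_def poly_prod intro!: bexI[of _ z])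
      then show ?thesis using that by (simp add: p_def poly_monom Fq_def)
    qed
  qed (simp_all add: deg_r card_Fq)
  then have "poly r y = y ^ q - y" by (auto simp: p_def poly_monom)
  then show ?thesis by (simp add: r_def poly_prod)
qed

lemma v_prod_le_0: "(\<And>i. i \<in> I \<Longrightarrow> v (f i) \<le> 0) \<Longrightarrow> v (prod f I) \<le> 0"
proof (induction I rule: infinite_finite_induct)
  case (insert i I)
  then show ?case using add_mono[of "v (f i)" 0 "v (prod f I)" 0] by (simp add: v_mult)
qed auto

text \<open>Otherwise every factor of y^q - y, the product of all y - a, would have valuation at
  most 0. This later selects a root of larger valuation.\<close>

lemma Artin_Schreier_near_Fq:
  assumes "0 < v (y ^ q - y)"
  obtains a where "a \<in> Fq q" "0 < v (y - a)"
proof -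
  have "\<exists>a\<in>Fq q. 0 < v (y - a)"
  proof (rule ccontr)
    assume "\<not> ?thesis"
    then have "v (\<Prod>a\<in>Fq q. y - a) \<le> 0" by (intro v_prod_le_0) (auto simp: not_less)
    then show False using assms by (simp add: prod_Fq)
  qed
  then show ?thesis using that by blast
qed

end

context drinfeld_module
begin

lemma phi_0 [simp]: "phi 0 = 0"
  using q_pos by (simp add: drinfeld_T_def power_0_left)

lemma efun_FqT_mult: "f \<in> FqT_poly q T \<Longrightarrow> efun z = 0 \<Longrightarrow> efun (f * z) = 0"
proof (induction f rule: FqT_poly_induct)
  case (step a g)
  have "efun ((a + T * g) * z) = efun (a * z) + efun (T * (g * z))"
    by (simp add: distrib_right mult.assoc flip: efun_add)
  then show ?case using step by (simp add: efun_Fq efun_T)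
qed simp

end

context drinfeld_radius
begin

text \<open>
  If \<open>z\<close> is a period then \<open>exp (z / T)\<close> is \<open>T\<close>-torsion, so \<open>z\<close> is an \<open>F\<^sub>q\<close>-combination of the
  two candidate generators plus \<open>T\<close> times a period whose valuation is larger by one, until it
  enters the disc on which \<open>exp\<close> is injective.
\<close>

lemma period_lattice_generated:
  assumes D1: "ereal (w - 1) < v d" and D2: "ereal (w - 1) < v e"
    and tors: "phi d = 0" "phi e = 0"
    and span: "\<And>x. phi x = 0 \<Longrightarrow> \<exists>a\<in>Fq q. \<exists>b\<in>Fq q. x = a * d + b * e"
  shows "period_lattice q v T A B = FqT_span2 q T (T * lfun d) (T * lfun e)"
proof
  show "FqT_span2 q T (T * lfun d) (T * lfun e) \<subseteq> period_lattice q v T A B"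
    using torsion_lfun_period[OF D1 tors(1)] torsion_lfun_period[OF D2 tors(2)] efun_FqT_mult
    by (auto simp: FqT_span2_def period_lattice_iff efun_add)
  have "z \<in> FqT_span2 q T (T * lfun d) (T * lfun e)"
    if "efun z = 0" "ereal (w - 1 - real n) < v z" for n z
    using that
  proof (induction n arbitrary: z)
    case 0
    then have "z = 0" using efun_eq_0 by simp
    then show ?case using FqT_poly_0 by (force simp: FqT_span2_def)
  next
    case (Suc n)
    have "phi (efun (z / T)) = 0" using efun_T[of "z / T"] T_nonzero Suc.prems by simp
    then obtain a b where ab: "a \<in> Fq q" "b \<in> Fq q" "efun (z / T) = a * d + b * e"
      using span by blast
    \<comment> \<open>exp maps \<open>u\<close> and z / T to the same torsion point, so their
      difference is again a period.\<close>
    define u where "u = a * lfun d + b * lfun e"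
    define y where "y = z / T - u"
    have "efun y = 0"
      by (simp add: y_def u_def efun_diff efun_add efun_Fq ab efun_lfun D1 D2)
    moreover have "ereal (w - 1 - real n) < v y"
    proof -
      have "ereal (w - 1 - real n) < v (z / T)"
      proof (cases z rule: v_real_cases)
        case (2 r)
        then show ?thesis using Suc.prems(2) v_divide[OF 2(2) v_T_ereal] by simp
      qed simp
      moreover have "ereal (w - 1) < v (a * lfun d)" "ereal (w - 1) < v (b * lfun e)"
        using v_Fq_mult_ge[OF ab(1), of "lfun d"] v_Fq_mult_ge[OF ab(2), of "lfun e"] D1 D2
        by (auto simp: v_lfun intro: less_le_trans)
      then have "ereal (w - 1) < v u"
        unfolding u_def by (metis v_add less_le_trans min_less_iff_conj)
      then have "ereal (w - 1 - real n) < v u"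
        by (rule le_less_trans[rotated]) simp
      ultimately show ?thesis
        unfolding y_def by (metis v_diff less_le_trans min_less_iff_conj)
    qed
    ultimately obtain f g where fg: "f \<in> FqT_poly q T" "g \<in> FqT_poly q T"
      "y = f * (T * lfun d) + g * (T * lfun e)"
      using Suc.IH[of y] by (auto simp: FqT_span2_def)
    have "z = T * (u + y)" using T_nonzero by (simp add: y_def)
    also have "\<dots> = (a + T * f) * (T * lfun d) + (b + T * g) * (T * lfun e)"
      by (simp add: u_def fg algebra_simps)
    finally show ?case
      unfolding FqT_span2_def using FqT_poly_step ab fg by blast
  qed
  moreover have "\<exists>n. ereal (w - 1 - real n) < v z" for z
  proof (cases z rule: v_real_cases)
    case (2 r)
    obtain n :: nat where "real n > w - 1 - r" using reals_Archimedean2 by blast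
    then show ?thesis using 2 by (intro exI[of _ n]) simp
  qed simp
  ultimately show "period_lattice q v T A B \<subseteq> FqT_span2 q T (T * lfun d) (T * lfun e)"
    unfolding period_lattice_iff subset_iff by blast
qed

end

section \<open>The F_q-basis \<delta>, \<zeta> of the T-torsion, here called \<open>d\<close> and
  \<open>e\<close>\<close>

locale torsion_basis = drinfeld_module q v T A B
  for q :: nat and v :: "'a::field \<Rightarrow> ereal" and T A B :: 'a +
  fixes d \<theta> c e :: 'a
  assumes d_nonzero: "d \<noteq> 0"
    and B_nonzero: "B \<noteq> 0"
    and d_torsion: "B * d ^ (q\<^sup>2) + A * d ^ q + T * d = 0"
    and \<theta>: "\<theta> ^ (q - 1) = T / B"
    and c: "c = inverse d * \<theta>"
    and e: "e ^ q - d ^ (q - 1) * e = c"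
begin

lemma d_power: "d ^ q = d ^ (q - 1) * d"
  using q_pos by (simp add: power_eq_if mult.commute)

lemma c_nonzero: "c \<noteq> 0"
  using \<theta> T_nonzero B_nonzero d_nonzero q_minus_1_pos by (auto simp: c power_0_left)

text \<open>In the twisted polynomial ring, \<open>\<phi>\<^sub>T = (B\<tau> - T / d\<^sup>q\<^sup>-\<^sup>1) (\<tau> - d\<^sup>q\<^sup>-\<^sup>1)\<close>.\<close>

lemma phi_factor:
  "phi x = B * (x ^ q - d ^ (q - 1) * x) ^ q - T / d ^ (q - 1) * (x ^ q - d ^ (q - 1) * x)"
proof -
  define D where "D = d ^ (q - 1)"
  have D: "D \<noteq> 0" using d_nonzero by (simp add: D_def)
  have "d ^ (q\<^sup>2) = D ^ q * D * d"
    using d_power by (simp add: D_def power2_eq_square power_mult power_mult_distrib)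
  then have "(B * D ^ q * D + A * D + T) * d = 0"
    using d_torsion by (simp add: d_power D_def algebra_simps)
  then have "A * D + (B * D ^ q * D + T) = 0"
    using d_nonzero by (simp add: add_ac)
  \<comment> \<open>The torsion equation of \<open>d\<close>, divided by \<open>d\<close>, expresses
    \<open>A\<close> through \<open>D\<close>; inserting this is what makes \<phi>_T factor.\<close>
  then have A: "A * D = - (B * D ^ q * D) - T"
    by (simp add: add_eq_0_iff2)
  have "phi x * D = (B * (x ^ q - D * x) ^ q - T / D * (x ^ q - D * x)) * D"
  proof -
    have "phi x * D = T * D * x + (A * D) * x ^ q + B * D * (x ^ q) ^ q"
      by (simp add: drinfeld_T_def power2_eq_square power_mult algebra_simps)
    also have "\<dots> = (B * ((x ^ q) ^ q - D ^ q * x ^ q) - T / D * (x ^ q - D * x)) * D"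
      unfolding A using D by (simp add: field_simps)
    finally show ?thesis by (simp add: frob_diff1 power_mult_distrib)
  qed
  then show ?thesis unfolding mult_right_cancel[OF D] by (simp only: D_def)
qed

text \<open>Says that \<open>c\<close> lies in the kernel of the left factor of \<phi>_T, which is
  the reason for the (q-1)-st root of T / B.\<close>

lemma c_power: "B * c ^ q = T / d ^ (q - 1) * c"
proof -
  have "c ^ q = c ^ (q - 1) * c" using q_pos by (simp add: power_eq_if mult.commute)
  moreover have "c ^ (q - 1) = T / B / d ^ (q - 1)"
    using \<theta> by (simp add: c power_mult_distrib power_inverse field_simps del: One_nat_def)
  ultimately show ?thesis using B_nonzero by simp
qed

lemma phi_d: "phi d = 0"
  using d_torsion by (simp add: drinfeld_T_def algebra_simps)

lemma phi_e: "phi e = 0"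
  unfolding phi_factor e using c_power by simp

lemma e_nonzero: "e \<noteq> 0"
  using e c_nonzero q_pos by (auto simp: power_0_left)

text \<open>The right factor sends \<open>x\<close> into the kernel of the left factor, which is F_q
  c. Subtracting a multiple of \<open>e\<close>, which is sent to \<open>c\<close>, leaves an
  element of the kernel F_q d of the right factor.\<close>

lemma phi_span:
  assumes "phi x = 0"
  shows "\<exists>a\<in>Fq q. \<exists>b\<in>Fq q. x = a * d + b * e"
proof -
  define y where "y = x ^ q - d ^ (q - 1) * x"
  have c': "c ^ q = c ^ (q - 1) * c" using q_pos by (simp add: power_eq_if mult.commute)
  have "B * y ^ q = T / d ^ (q - 1) * y" using assms by (simp add: phi_factor y_def)
  moreover have "T / d ^ (q - 1) = B * c ^ (q - 1)"
  proof -
    have "T / d ^ (q - 1) * c = B * c ^ (q - 1) * c"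
      using c_power unfolding c' by (simp only: mult.assoc)
    then show ?thesis by (simp only: mult_right_cancel[OF c_nonzero])
  qed
  ultimately have "B * y ^ q = B * (c ^ (q - 1) * y)" by (simp only: mult.assoc)
  then have "y ^ q = c ^ (q - 1) * y" by (simp only: mult_left_cancel[OF B_nonzero])
  then have "y / c \<in> Fq q" by (rule Fq_eigen[OF c_nonzero])
  then obtain k where k: "k \<in> Fq q" "y = k * c" using c_nonzero by (metis nonzero_eq_divide_eq)
  define x' where "x' = x - k * e"
  have "x' ^ q = x ^ q - k * e ^ q"
    unfolding x'_def frob_diff1 power_mult_distrib Fq_power[OF k(1), of 1, unfolded power_one_right] ..
  then have "x' ^ q - d ^ (q - 1) * x' = (x ^ q - d ^ (q - 1) * x) - k * (e ^ q - d ^ (q - 1) * e)"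
    by (simp add: x'_def algebra_simps)
  also have "\<dots> = 0" unfolding e y_def[symmetric] k(2) by simp
  finally have "x' / d \<in> Fq q" by (intro Fq_eigen d_nonzero) simp
  moreover have "x = x' / d * d + k * e" using d_nonzero by (simp add: x'_def)
  ultimately show ?thesis using k(1) by blast
qed

lemma torsion_iff: "x \<in> torsion_T q T A B \<longleftrightarrow> phi x = 0"
  by (simp add: torsion_T_def)

section \<open>Valuations of torsion points when v j >= -q\<close>

lemma v_torsion_terms:
  assumes "v x = ereal r" "v B = ereal b"
  shows "v (T * x) = ereal (r - 1)" "v (B * x ^ q\<^sup>2) = ereal (b + real q ^ 2 * r)"
    and "v A = ereal a \<Longrightarrow> v (A * x ^ q) = ereal (a + real q * r)"
  using v_power[OF assms(1)] assms by (simp_all add: v_mult v_T_ereal)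

text \<open>\<open>w\<close> balances the outer terms of \<phi>_T, and the condition on j keeps the
  middle term from being smaller there. For v x < w the \<open>B\<close> term would be the unique
  minimum, for v x > w the \<open>T\<close> term.\<close>

lemma one_slope:
  assumes b: "v B = ereal b" and w: "w = - (1 + b) / (real q ^ 2 - 1)"
    and j: "ereal (- real q) \<le> v (A ^ (q + 1) / B)"
  shows "drinfeld_radius q v T A B w"
    and "\<And>x. phi x = 0 \<Longrightarrow> x \<noteq> 0 \<Longrightarrow> v x = ereal w"
proof -
  define Q where "Q = real q"
  have Q: "Q \<ge> 2" using q_ge_2 by (simp add: Q_def)
  have Q2: "Q ^ 2 - 1 = (Q - 1) * (Q + 1)" by (simp add: algebra_simps power2_eq_square)
  have Q2': "Q ^ 2 - 1 > 0" unfolding Q2 using Q by simp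
  have b': "b = - 1 - (Q ^ 2 - 1) * w" using Q2' by (simp add: w Q_def)
  have a: "- 1 - (Q - 1) * w \<le> a" if "v A = ereal a" for a
  proof -
    have "v (A ^ (q + 1) / B) = ereal (real (q + 1) * a - b)"
      by (intro v_divide v_power that b)
    then have "- Q \<le> (Q + 1) * a - b" using j by (simp add: Q_def add.commute)
    \<comment> \<open>By \<open>b'\<close> the left side is b - Q, so this is the condition on j
      rewritten.\<close>
    then have "(Q + 1) * (- 1 - (Q - 1) * w) \<le> (Q + 1) * a"
      by (simp add: b' Q2 algebra_simps)
    then show ?thesis using Q by simp
  qed
  have vA: "ereal (- 1 - (Q - 1) * w) \<le> v A"
    by (cases A rule: v_real_cases) (use a in auto)
  show "drinfeld_radius q v T A B w"
    by unfold_locales (use vA b b' in \<open>auto simp: Q_def\<close>)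
  fix x assume x: "phi x = 0" "x \<noteq> 0"
  obtain r where r: "v x = ereal r" using x(2) by (cases x rule: v_real_cases) auto
  have sum: "T * x + A * x ^ q + B * x ^ q\<^sup>2 = 0" using x(1) by (simp add: drinfeld_T_def)
  note t = v_torsion_terms[OF r b, folded Q_def]
  have Ax: "ereal (- 1 - (Q - 1) * w + Q * r) \<le> v (A * x ^ q)"
    unfolding Q_def using vA r by (intro v_mult_ge v_power_ge) (auto simp: Q_def)
  have "\<not> r < w"
  proof
    assume less: "r < w"
    then have "(Q ^ 2 - 1) * r < (Q ^ 2 - 1) * w" and "(Q ^ 2 - Q) * r < (Q ^ 2 - Q) * w"
      using Q Q2' by (simp_all add: power2_eq_square)
    then have "b + Q ^ 2 * r < r - 1" "b + Q ^ 2 * r < - 1 - (Q - 1) * w + Q * r"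
      by (simp_all add: b' algebra_simps)
    then have "v (B * x ^ q\<^sup>2) < v (T * x)" "v (B * x ^ q\<^sup>2) < v (A * x ^ q)"
      using less_le_trans[OF _ Ax] by (simp_all add: t)
    then show False using zero_sum_min_attained_twice[of "B * x ^ q\<^sup>2" "T * x" "A * x ^ q"] sum
      by (simp add: algebra_simps)
  qed
  moreover have "\<not> w < r"
  proof
    assume less: "w < r"
    then have "(Q ^ 2 - 1) * w < (Q ^ 2 - 1) * r" and "(Q - 1) * w < (Q - 1) * r"
      using Q Q2' by simp_all
    then have "r - 1 < b + Q ^ 2 * r" "r - 1 < - 1 - (Q - 1) * w + Q * r"
      by (simp_all add: b' algebra_simps)
    then have "v (T * x) < v (B * x ^ q\<^sup>2)" "v (T * x) < v (A * x ^ q)"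
      using less_le_trans[OF _ Ax] by (simp_all add: t)
    then show False using zero_sum_min_attained_twice[of "T * x" "B * x ^ q\<^sup>2" "A * x ^ q"] sum
      by (simp add: algebra_simps)
  qed
  ultimately show "v x = ereal w" using r by simp
qed

end

section \<open>The case v j < -q: two slopes\<close>

locale two_slopes = torsion_basis q v T A B d \<theta> c e
  for q :: nat and v :: "'a::field \<Rightarrow> ereal" and T A B d \<theta> c e :: 'a +
  fixes a b w1 w2 :: real
  assumes a: "v A = ereal a" and b: "v B = ereal b"
    and w1: "w1 = - (1 + a) / (real q - 1)" and w2: "w2 = (a - b) / (real q ^ 2 - real q)"
    and j_small: "(real q + 1) * a - b < - real q"
begin

lemma a_eq: "a = - 1 - (real q - 1) * w1"
  using q_ge_2 by (simp add: w1)

lemma b_eq: "b = a - (real q ^ 2 - real q) * w2"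
  using q_ge_2 by (simp add: w2 power2_eq_square)

text \<open>The right side is - q - v j. So v j < -q means that w1 - w2 is positive, and v j > -q^2
  that it is less than 1.\<close>

lemma w_diff: "(real q ^ 2 - real q) * (w1 - w2) = - real q - ((real q + 1) * a - b)"
proof -
  have "(real q ^ 2 - real q) * (w1 - w2) = real q * ((real q - 1) * w1) - (real q ^ 2 - real q) * w2"
    by (simp add: algebra_simps power2_eq_square)
  also have "(real q - 1) * w1 = - 1 - a" using a_eq by simp
  also have "(real q ^ 2 - real q) * w2 = a - b" using b_eq by simp
  finally show ?thesis by (simp add: algebra_simps)
qed

lemma q2_q_pos: "real q ^ 2 - real q > 0"
  using q_ge_2 by (simp add: power2_eq_square)

lemma w2_less_w1: "w2 < w1"
proof -
  have "0 < (real q ^ 2 - real q) * (w1 - w2)" using w_diff j_small by simp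
  then show ?thesis using q2_q_pos by (simp add: zero_less_mult_iff)
qed

lemma w2_gt_iff: "w1 - 1 < w2 \<longleftrightarrow> - (real q ^ 2) < (real q + 1) * a - b"
proof -
  have "w1 - 1 < w2 \<longleftrightarrow> (real q ^ 2 - real q) * (w1 - w2) < (real q ^ 2 - real q) * 1"
    unfolding mult_less_cancel_left_pos[OF q2_q_pos] by auto
  then show ?thesis unfolding w_diff by auto
qed

text \<open>Makes w1 an admissible choice of \<open>w\<close>, with equality for \<open>A\<close> by
  \<open>a_eq\<close> and strictness for \<open>B\<close>: the situation in which the disc is the
  exact domain of convergence of the logarithm.\<close>

lemma b_gt: "- 1 - (real q ^ 2 - 1) * w1 < b"
proof -
  have "(real q ^ 2 - real q) * w2 < (real q ^ 2 - real q) * w1"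
    using w2_less_w1 q2_q_pos by simp
  then show ?thesis by (simp add: b_eq a_eq algebra_simps power2_eq_square)
qed

sublocale drinfeld_radius q v T A B w1
  by unfold_locales (use a a_eq b b_gt in auto)

text \<open>The first two terms of \<phi>_T(x) compare by the sign of v x - w1, the last two by that
  of v x - w2. As w2 < w1, the minimum is attained twice only at these two values.\<close>

lemma v_torsion:
  assumes "phi x = 0" "x \<noteq> 0"
  shows "v x = ereal w1 \<or> v x = ereal w2"
proof -
  obtain r where r: "v x = ereal r" using assms(2) by (cases x rule: v_real_cases) auto
  have sum: "T * x + A * x ^ q + B * x ^ q\<^sup>2 = 0" using assms(1) by (simp add: drinfeld_T_def)
  note t = v_torsion_terms(1,2)[OF r b] v_torsion_terms(3)[OF r b a]
  define t1 t2 t3 where "t1 = r - 1" and "t2 = a + real q * r" and "t3 = b + real q ^ 2 * r"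
  have t2: "t2 = t1 + (real q - 1) * (r - w1)"
    by (simp add: t1_def t2_def a_eq algebra_simps)
  have t3: "t3 = t2 + (real q ^ 2 - real q) * (r - w2)"
    by (simp add: t2_def t3_def b_eq algebra_simps)
  have sgn: "t1 < t2 \<longleftrightarrow> w1 < r" "t2 < t1 \<longleftrightarrow> r < w1" "t2 < t3 \<longleftrightarrow> w2 < r" "t3 < t2 \<longleftrightarrow> r < w2"
    using q_ge_2 q2_q_pos unfolding t2 t3
    by (auto simp: zero_less_mult_iff mult_less_0_iff)
  have "\<not> (t1 < t2 \<and> t1 < t3)" "\<not> (t2 < t1 \<and> t2 < t3)" "\<not> (t3 < t1 \<and> t3 < t2)"
    using zero_sum_min_attained_twice[of "T * x" "A * x ^ q" "B * x ^ q\<^sup>2"]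
      zero_sum_min_attained_twice[of "A * x ^ q" "T * x" "B * x ^ q\<^sup>2"]
      zero_sum_min_attained_twice[of "B * x ^ q\<^sup>2" "T * x" "A * x ^ q"] sum
    by (auto simp: t t1_def t2_def t3_def algebra_simps)
  then have "r = w1 \<or> r = w2" using sgn w2_less_w1 by linarith
  then show ?thesis using r by simp
qed

lemma log_converges_w1: "v x = ereal w1 \<Longrightarrow> log_converges q v T A B x"
  by (rule log_converges_gt) simp

lemma period_w1: "v x = ereal w1 \<Longrightarrow> phi x = 0 \<Longrightarrow> T * lfun x \<in> period_lattice q v T A B"
  by (rule torsion_lfun_period) simp_all

lemma v_torsion_ge:
  assumes "w1 - 1 < w2" "phi x = 0"
  shows "ereal (w1 - 1) < v x"
  using v_torsion[OF assms(2)] assms(1) by (cases "x = 0") auto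

text \<open>Only torsion points of the smaller valuation can leave the domain of convergence. Such a
  point is \<delta> or \<zeta>, depending on the case.\<close>

lemma log_converges_torsion_iff:
  assumes "phi x = 0" "v x = ereal w2"
  shows "(\<forall>y\<in>torsion_T q T A B. log_converges q v T A B y) \<longleftrightarrow> w1 - 1 < w2"
proof
  assume "\<forall>y\<in>torsion_T q T A B. log_converges q v T A B y"
  then have "log_converges q v T A B x" using assms by (simp add: torsion_iff)
  moreover have "v A = ereal (- 1 - (real q - 1) * w1)" "ereal (- 1 - (real q ^ 2 - 1) * w1) < v B"
    using a a_eq b b_gt by simp_all
  ultimately have "\<not> v x \<le> ereal (w1 - 1)" using log_diverges by blast
  then show "w1 - 1 < w2" using assms by simp
next
  assume "w1 - 1 < w2"
  then show "\<forall>y\<in>torsion_T q T A B. log_converges q v T A B y"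
    using v_torsion_ge log_converges_gt by (simp add: torsion_iff)
qed

lemma lattice:
  assumes "w1 - 1 < w2"
  shows "period_lattice q v T A B = FqT_span2 q T (T * lfun d) (T * lfun e)"
  using assms by (intro period_lattice_generated v_torsion_ge phi_d phi_e phi_span)

lemma v_c:
  assumes "v d = ereal r"
  shows "v c = ereal (w1 + real q * w2 - r)"
proof -
  have "\<theta> \<noteq> 0" using c_nonzero c by auto
  then obtain t where t: "v \<theta> = ereal t" by (cases \<theta> rule: v_real_cases) auto
  have "ereal (real (q - 1) * t) = ereal (- 1 - b)"
    using v_power[OF t, of "q - 1"] v_divide[OF v_T_ereal b] \<theta> by simp
  \<comment> \<open>Rewrites v(T / B) through the two slopes, so that dividing by q - 1 yields the
    valuation of \<theta>.\<close>
  also have "- 1 - b = (real q - 1) * (w1 + real q * w2)"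
    by (simp add: b_eq a_eq algebra_simps power2_eq_square)
  finally have "t = w1 + real q * w2" using q_ge_2 by (simp add: q_minus_1_real)
  then show ?thesis using v_divide[OF t assms] by (simp add: c divide_inverse mult.commute)
qed

text \<open>If \<open>e\<close> also had valuation w1, both terms of its equation would have
  valuation q w1, whereas v c = q w2 is smaller.\<close>

lemma v_e_if_v_d_w1:
  assumes "v d = ereal w1"
  shows "v e = ereal w2"
proof (rule ccontr)
  assume "v e \<noteq> ereal w2"
  then have e1: "v e = ereal w1" using v_torsion[OF phi_e e_nonzero] by blast
  have "v (d ^ (q - 1) * e) = ereal (real q * w1)"
    using v_power[OF assms, of "q - 1"] e1
    by (simp add: v_mult q_minus_1_real algebra_simps del: One_nat_def)
  then have "ereal (real q * w1) \<le> v c"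
    unfolding e[symmetric] using v_power[OF e1, of q] by (intro v_diff_ge) simp_all
  then show False using v_c[OF assms] w2_less_w1 q_pos by simp
qed

text \<open>The element e - k d solves the same equation for every k in F_q. Dividing the equation
  by d^q turns it into y^q - y = c / d^q with y = e / d. The right side has valuation w1 - w2 > 0,
  so y is close to some k, and e - k d has valuation above w2.\<close>

lemma exists_w1:
  assumes "v d = ereal w2"
  shows "\<exists>x. x ^ q - d ^ (q - 1) * x = c \<and> v x = ereal w1"
proof -
  have "(e / d) ^ q - e / d = c / d ^ q"
    unfolding e[symmetric] using d_nonzero by (simp add: power_divide d_power field_simps)
  moreover have "v (c / d ^ q) = ereal (w1 + real q * w2 - w2 - real q * w2)"
    by (intro v_divide v_c v_power assms)
  ultimately have "0 < v ((e / d) ^ q - e / d)" using w2_less_w1 by simp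
  then obtain k where k: "k \<in> Fq q" "0 < v (e / d - k)" by (rule Artin_Schreier_near_Fq)
  define x where "x = e - k * d"
  have "x ^ q = e ^ q - k * d ^ q"
    using Fq_power[OF k(1), of 1] by (simp add: x_def frob_diff1 power_mult_distrib)
  then have x: "x ^ q - d ^ (q - 1) * x = c"
    by (simp add: x_def e[symmetric] d_power algebra_simps)
  \<comment> \<open>As another root of the same equation, \<open>x\<close> may take the place of
    \<open>e\<close>; so it is a nonzero torsion point.\<close>
  interpret x: torsion_basis q v T A B d \<theta> c x
    by unfold_locales (use d_nonzero B_nonzero d_torsion \<theta> c x in auto)
  have "x = d * (e / d - k)" using d_nonzero by (simp add: x_def algebra_simps)
  then have "v x = ereal w2 + v (e / d - k)" using v_mult assms by metis
  then have "v x \<noteq> ereal w2" using k(2) by (cases "v (e / d - k)") auto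
  then have "v x = ereal w1" using v_torsion[OF x.phi_e x.e_nonzero] by blast
  then show ?thesis using x by blast
qed

end

text \<open>In case (iii) the roots of the equation for \<zeta> are \<zeta> + k \<delta> with k in
  F_q, and those of larger valuation than \<delta> are not singled out by the equation: adding
  \<delta> to such a root gives one with the valuation of \<delta>. Hence that case asserts that a
  root of the larger valuation exists and gives the valuation of \<zeta> when it differs from that
  of \<delta>; the statements on the torsion and the lattice hold for every root.\<close>

theorem theorem5p3:
  fixes q :: nat and v :: "'a::field \<Rightarrow> ereal" and T A B \<delta> j \<theta> c \<zeta> :: 'a
  assumes C: "C_infinity q v T"
    and \<delta>0: "\<delta> \<noteq> 0"
    and B0: "B \<noteq> 0"
    and \<delta>: "B * \<delta> ^ (q\<^sup>2) + A * \<delta> ^ q + T * \<delta> = 0"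
    and j_eq: "j = A ^ (q + 1) / B"
    and \<theta>: "\<theta> ^ (q - 1) = T / B"
    and c: "c = inverse \<delta> * \<theta>"
    and \<zeta>: "\<zeta> ^ q - \<delta> ^ (q - 1) * \<zeta> = c"
  shows
    "(v j \<ge> ereal (- real q) \<longrightarrow>
        v \<delta> = (- (1 + v B)) / ereal (real q ^ 2 - 1) \<and>
        v \<zeta> = (- (1 + v B)) / ereal (real q ^ 2 - 1) \<and>
        log_converges q v T A B \<delta> \<and>
        log_converges q v T A B \<zeta> \<and>
        period_lattice q v T A B =
          FqT_span2 q T (T * log_eval q v T A B \<delta>) (T * log_eval q v T A B \<zeta>))
     \<and>
     (v j < ereal (- real q) \<and> v \<delta> = (- (1 + v A)) / ereal (real q - 1) \<longrightarrow>
        log_converges q v T A B \<delta> \<and>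
        T * log_eval q v T A B \<delta> \<in> period_lattice q v T A B \<and>
        v \<zeta> = (v A - v B) / ereal (real q ^ 2 - real q) \<and>
        ((\<forall>x \<in> torsion_T q T A B. log_converges q v T A B x) \<longleftrightarrow>
           v j > ereal (- (real q ^ 2))) \<and>
        (v j > ereal (- (real q ^ 2)) \<longrightarrow>
           period_lattice q v T A B =
             FqT_span2 q T (T * log_eval q v T A B \<delta>) (T * log_eval q v T A B \<zeta>)))
     \<and>
     (v j < ereal (- real q) \<and> v \<delta> = (v A - v B) / ereal (real q ^ 2 - real q) \<longrightarrow>
        (\<exists>\<xi>. \<xi> ^ q - \<delta> ^ (q - 1) * \<xi> = c \<and> v \<xi> = (- (1 + v A)) / ereal (real q - 1)) \<and>
        (v \<zeta> \<noteq> v \<delta> \<longrightarrow>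
           v \<zeta> = (- (1 + v A)) / ereal (real q - 1) \<and>
           log_converges q v T A B \<zeta> \<and>
           T * log_eval q v T A B \<zeta> \<in> period_lattice q v T A B) \<and>
        ((\<forall>x \<in> torsion_T q T A B. log_converges q v T A B x) \<longleftrightarrow>
           v j > ereal (- (real q ^ 2))) \<and>
        (v j > ereal (- (real q ^ 2)) \<longrightarrow>
           period_lattice q v T A B =
             FqT_span2 q T (T * log_eval q v T A B \<delta>) (T * log_eval q v T A B \<zeta>)))"
proof -
  interpret C_infinity q v T by (rule C)
  interpret torsion_basis q v T A B \<delta> \<theta> c \<zeta>
    by unfold_locales (use \<delta>0 B0 \<delta> \<theta> c \<zeta> in auto)
  obtain b where b: "v B = ereal b" using B0 by (cases B rule: v_real_cases) auto
  show ?thesis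
  proof (cases "ereal (- real q) \<le> v j")
    case True
    define w where "w = - (1 + b) / (real q ^ 2 - 1)"
    note slope = one_slope[OF b w_def True[unfolded j_eq]]
    interpret drinfeld_radius q v T A B w by (rule slope)
    have v: "v \<delta> = ereal w" "v \<zeta> = ereal w"
      using slope(2) phi_d phi_e \<delta>0 e_nonzero by auto
    have "1 < real q ^ 2" using q_ge_2 by (intro one_less_power) auto
    then have "(- (1 + v B)) / ereal (real q ^ 2 - 1) = ereal w"
      by (simp add: b w_def one_ereal_def)
    moreover have "period_lattice q v T A B = FqT_span2 q T (T * lfun \<delta>) (T * lfun \<zeta>)"
      by (intro period_lattice_generated phi_d phi_e phi_span) (simp_all add: v)
    moreover have "\<not> v j < ereal (- real q)" using True by (simp only: not_less)
    moreover have "log_converges q v T A B \<delta>" "log_converges q v T A B \<zeta>"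
      by (intro log_converges_gt; simp add: v)+
    ultimately show ?thesis using v by (simp only: log_eval_eq) simp
  next
    case False
    \<comment> \<open>For A = 0 also j = 0, whose valuation is infinite.\<close>
    have "A \<noteq> 0" using False j_eq by auto
    then obtain a where a: "v A = ereal a" by (cases A rule: v_real_cases) auto
    have "v j = ereal (real (q + 1) * a - b)"
      unfolding j_eq by (intro v_divide v_power a b)
    then have vj: "v j = ereal ((real q + 1) * a - b)" by (simp add: add.commute)
    define w1 w2 where "w1 = - (1 + a) / (real q - 1)" and "w2 = (a - b) / (real q ^ 2 - real q)"
    interpret two_slopes q v T A B \<delta> \<theta> c \<zeta> a b w1 w2
      by unfold_locales (use a b False vj in \<open>auto simp: w1_def w2_def\<close>)
    have w1': "(- (1 + v A)) / ereal (real q - 1) = ereal w1"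
      using q_ge_2 by (simp add: a w1_def one_ereal_def)
    have w2': "(v A - v B) / ereal (real q ^ 2 - real q) = ereal w2"
      using q2_q_pos by (simp add: a b w2_def)
    have gt: "v j > ereal (- (real q ^ 2)) \<longleftrightarrow> w1 - 1 < w2"
      by (simp add: vj w2_gt_iff)
    \<comment> \<open>The torsion point of smaller valuation w2 that decides convergence is \<zeta>
      in case (ii) and \<delta> in case (iii).\<close>
    show ?thesis
      unfolding w1' w2' gt log_eval_eq
      using False v_e_if_v_d_w1 log_converges_w1 period_w1 phi_d phi_e lattice exists_w1
        log_converges_torsion_iff[OF phi_d] log_converges_torsion_iff[OF phi_e]
        v_torsion[OF phi_e e_nonzero]
      by auto
  qed
qed

end
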